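(* Let $\{K_m\}_{m\ge 0}$ be a sequence of obstacles taken from a finite collection $\{K_\sigma:\sigma\in\mathcal J\}$ of pairwise disjoint smooth compact strictly convex obstacles in $\mathbb R^2$, let $\alpha\in\mathbb R^2$, $|\alpha|=1$, and suppose that Assumptions A and B (both stated in the context) hold. With $\rho^{\rm slow}_{m,\beta}$ and $W_m$ as defined in the context, for any $m,\beta\in\mathbb Z_+$ we have $$\rho_{m,\beta}^{\rm slow}(s,k)\in S^{-\frac{\beta}{3}}_{\frac23,\frac13}([0,P_m]\times(0,\infty)).$$ Moreover, for any $k_0>1$ and $n\in\mathbb Z_+$, there is a constant $C$ independent of $(s,k)$ such that $$|D_s^n\rho_{m,\beta}^{\rm slow}(s,k)|\le C\,k^{-\frac\beta3}\,W_m(s,k)^{-n}\qquad\text{for all }(s,k)\in[0,P_m]\times[k_0,\infty).$$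
   Context: **Symbol classes.** For a smooth manifold $M$ (possibly an open subset of a curve or of $\mathbb R^2$, or an interval), $a\in C^\infty(M\times(0,\infty))$ belongs to the Hörmander class $S^\mu_{\varrho,\delta}(M\times(0,\infty))$ if for every compact $W\subset M$ (in local coordinates), every $k_0>0$, every multi-index $\beta$ and every $n\in\mathbb Z_+$ there is $C$ with $|D_x^\beta D_k^n a(x,k)|\le C(1+k)^{\mu-\varrho n+\delta|\beta|}$ for $x\in W$, $k\ge k_0$. If $\{a_\iota\}$ is a countable family with $a_\iota\in S^{\mu_\iota}_{\varrho,\delta}$ and only finitely many $\mu_\iota$ above any given real number, $a\sim\sum a_\iota$ means: for every $N$ there is a finite index set $F$ such that $a-\sum_{\iota\in F'}a_\iota\in S^{-N}_{\varrho,\delta}$ for all finite $F'\supset F$. A function of $(x,k)$ decreases rapidly in the sense of Schwartz as $k\to\infty$ on a compact set if all its derivatives in $x$ and $k$ are $O(k^{-N})$ there for every $N$; a function of $\tau\in\mathbb R$ decreases rapidly in the sense of Schwartz as $\tau\to-\infty$ if all its derivatives are $O(|\tau|^{-N})$ for every $N$. The expansion of $\Psi^{r,\ell}(\tau)$ as $\tau\to\infty$ below is understood in the symbol sense, i.e. it may be differentiated term by term. Here $t_-=\min\{t,0\}$ and $\mathbb Z_+=\mathbb N\cup\{0\}$. **Scattering problems.** $\nu$ is the exterior unit normal to the obstacle boundaries and $u^{\rm inc}(x,k)=e^{ik\alpha\cdot x}$, $k>0$. The fields $u_m$ solve iteratively: $(\Delta+k^2)u_m=0$ in $\mathbb R^2\setminus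 K_m$; $\partial_\nu u_0=-\partial_\nu u^{\rm inc}$ on $\partial K_0$ and $\partial_\nu u_m=-\partial_\nu u_{m-1}$ on $\partial K_m$ for $m\ge1$; $\lim_{r\to\infty}\sqrt r(\partial_r u_m-iku_m)=0$, $r=|x|$. The multiple scattering total fields are $\eta_0=u_0+u^{\rm inc}$ on $\partial K_0$ and $\eta_m=u_m+u_{m-1}$ on $\partial K_m$ for $m\ge1$. **Assumption A.** $K_{m+1}\ne K_m$ for all $m\ge0$; $\{x+t\alpha:x\in K_0,t\ge0\}\cap K_1=\varnothing$ (no-occlusion); and $K_{m+1}\cap\overline{co}(K_m\cup K_{m+2})=\varnothing$ for all $m\ge0$ (visibility), $\overline{co}$ being the closed convex hull. **Assumption B.** There is a family of smooth functions $\Psi^{r,\ell}:\mathbb R\to\mathbb C$ ($r\in\mathbb Z_+$, $\ell\in-\mathbb N$) with $\Psi^{r,\ell}(\tau)\sim\sum_{j\ge0}a_{r,\ell,j}\tau^{1+\ell-2r-3j}$ as $\tau\to\infty$ and rapid decrease in the sense of Schwartz as $\tau\to-\infty$ such that the following holds. Let $K\subset\mathbb R^2$ be a smooth compact strictly convex obstacle, $O\supset K$ open, and let $w$ satisfy $(\Delta+k^2)w=0$ and $w(x,k)=e^{ik\psi(x)}w^{\rm slow}(x,k)$ on $O$, where $\psi$ is a smooth phase whose wave-fronts $\{\psi=t\}$ are convex relative to the normal $\nabla\psi$ (plane waves $w=e^{ik\alpha\cdot x}$ are included), $w^{\rm slow}\in S^0_{1,0}(O\times(0,\infty))$ and $w^{\rm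 slow}(x,k)\sim\sum_{p\ge0}k^{-p}A_p(x)$ on $O$ with smooth $A_p$. Let $u$ be the outgoing (Sommerfeld) solution of $(\Delta+k^2)u=0$ in $\mathbb R^2\setminus K$ with $\partial_\nu u=-\partial_\nu w$ on $\partial K$, and let $\eta=w+u$, $\eta^{\rm slow}=e^{-ik\psi}\eta$ on $\partial K$. Let $\partial K^{\rm IL},\partial K^{\rm SB},\partial K^{\rm SR}$ be the subsets of $\partial K$ where $\nabla\psi\cdot\nu$ is $<0$, $=0$, $>0$ respectively. Then: (i) $\eta^{\rm slow}\in S^0_{1,0}(\partial K^{\rm IL}\times(0,\infty))$ and $\eta^{\rm slow}\sim\sum_{j\ge0}k^{-j}a_j(x)$ there with smooth complex $a_j$; (ii) on a $k$-independent neighborhood $\partial K^{\rm SB}_\epsilon$ of $\partial K^{\rm SB}$, $\eta^{\rm slow}\in S^0_{\frac23,\frac13}(\partial K^{\rm SB}_\epsilon\times(0,\infty))$ and $\eta^{\rm slow}\sim\sum_{p,q,r\ge0,\ell\le-1}k^{-\frac{1+2p+3q+r+\ell}{3}+(\ell+1)_-}b_{p,q,r,\ell}(x)(\Psi^{r,\ell})^{(p)}(k^{1/3}Z(x))$ with smooth complex $b_{p,q,r,\ell}$ and a smooth real $Z$ positive on $\partial K^{\rm IL}$, negative on $\partial K^{\rm SR}$, vanishing exactly to first order on $\partial K^{\rm SB}$; (iii) on compact subsets of $\partial K^{\rm SR}$, $\eta^{\rm slow}$ decreases rapidly in the sense of Schwartz as $k\to\infty$; (iv) $\eta^{\rm slow}\in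 S^0_{\frac23,\frac13}(\partial K\times(0,\infty))$ and the expansion in (ii) is valid on all of $\partial K$. **Rays, phases, regions.** Under Assumption A it is known that for every $m\ge1$ and $x\in\partial K_m$ there are unique points $(\mathcal X_0^m(x),\dots,\mathcal X_m^m(x))\in\partial K_0\times\cdots\times\partial K_m$ with $\mathcal X^m_m(x)=x$, $\alpha\cdot\nu(\mathcal X_0^m)<0$, $\frac{\mathcal X_1^m-\mathcal X_0^m}{|\mathcal X_1^m-\mathcal X_0^m|}=\alpha-2(\alpha\cdot\nu(\mathcal X_0^m))\nu(\mathcal X_0^m)$, and for $0<j<m$: $(\mathcal X^m_{j+1}-\mathcal X^m_j)\cdot\nu(\mathcal X^m_j)>0$ and $\frac{\mathcal X^m_{j+1}-\mathcal X^m_j}{|\mathcal X^m_{j+1}-\mathcal X^m_j|}=e_j-2(e_j\cdot\nu(\mathcal X_j^m))\nu(\mathcal X_j^m)$ with $e_j=\frac{\mathcal X^m_j-\mathcal X^m_{j-1}}{|\mathcal X^m_j-\mathcal X^m_{j-1}|}$. The phases are $\varphi_0(x)=\alpha\cdot x$ and $\varphi_m(x)=\alpha\cdot\mathcal X_0^m(x)+\sum_{j=0}^{m-1}|\mathcal X^m_{j+1}(x)-\mathcal X^m_j(x)|$, $m\ge1$, and the envelopes are defined by $\eta_m(x,k)=e^{ik\varphi_m(x)}\eta_m^{\rm slow}(x,k)$, $x\in\partial K_m$. Put $\alpha^{\rm inc}_0(x)=\alpha$ and, for $m\ge1$, $\alpha_m^{\rm inc}(x)=\frac{\mathcal X^m_m(x)-\mathcal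 X^m_{m-1}(x)}{|\mathcal X^m_m(x)-\mathcal X^m_{m-1}(x)|}$. Then $\partial K_m^{\rm IL}$, $\partial K_m^{\rm SB}$, $\partial K_m^{\rm SR}$ are the sets of $x\in\partial K_m$ with $\alpha_m^{\rm inc}(x)\cdot\nu(x)$ respectively $<0$, $=0$, $>0$. **The expansion of $\eta_m^{\rm slow}$.** Under Assumptions A and B, for every $m\in\mathbb Z_+$ one has $\eta_m^{\rm slow}\in S^0_{\frac23,\frac13}(\partial K_m\times(0,\infty))$ and, over all of $\partial K_m$, $\eta_m^{\rm slow}\sim\sum_{p,q,r\ge0,\ell\le-1}a_{m,p,q,r,\ell}$ with $$a_{m,p,q,r,\ell}(x,k)=k^{-\frac{1+2p+3q+r+\ell}{3}+(\ell+1)_-}b_{m,p,q,r,\ell}(x)(\Psi^{r,\ell})^{(p)}(k^{\frac13}Z_m(x)),$$ where $b_{m,p,q,r,\ell}$ are smooth complex-valued, and $Z_m$ is smooth real-valued, positive on $\partial K_m^{\rm IL}$, negative on $\partial K_m^{\rm SR}$, vanishing exactly to first order on $\partial K_m^{\rm SB}$. Moreover $\eta_m^{\rm slow}\in S^0_{1,0}(\partial K_m^{\rm IL}\times(0,\infty))$ with an expansion $\eta_m^{\rm slow}\sim\sum_{j\ge0}k^{-j}a_{m,j}(x)$ there with smooth $a_{m,j}$, and $\eta_m^{\rm slow}$ decreases rapidly in the sense of Schwartz as $k\to\infty$ on compact subsets of $\partial K_m^{\rm SR}$. Fix such an expansion. **Parameterization and definition of $\rho^{\rm slow}_{m,\beta}$,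 $W_m$.** $\gamma_m(s)$ is a smooth counterclockwise oriented $P_m$-periodic regular parameterization of $\partial K_m$; write $\eta_m^{\rm slow}(s,k)=\eta_m^{\rm slow}(\gamma_m(s),k)$ and $a_{m,p,q,r,\ell}(s,k)=a_{m,p,q,r,\ell}(\gamma_m(s),k)$. The shadow boundary is $\partial K_m^{\rm SB}=\{\gamma_m(t_{m,1}),\gamma_m(t_{m,2})\}$ with $t_{m,1},t_{m,2}\in(0,P_m)$, $\omega_m(s)=(s-t_{m,1})(t_{m,2}-s)$ and $W_m(s,k)=k^{-\frac13}+|\omega_m(s)|$. For $(p,q,r,\ell)\in\mathbb Z_+^3\times(-\mathbb N)$ let $$\vartheta(p,q,r,\ell)=-\tfrac{1+2p+3q+r+\ell}{3}+(\ell+1)_-+\begin{cases}0,&1+\ell-2r-p<0,\\ \frac{1+\ell-2r-p}{3},&1+\ell-2r-p\ge0.\end{cases}$$ For $\beta\in\mathbb Z_+$ let $\mathcal F_\beta=\{(p,q,r,\ell)\in\mathbb Z_+^3\times(-\mathbb N):\beta+3\vartheta(p,q,r,\ell)>0\}$, and $$\sigma^{\rm slow}_{m,\beta}(s,k)=\sum_{(p,q,r,\ell)\in\mathcal F_\beta}a_{m,p,q,r,\ell}(s,k),\qquad\rho^{\rm slow}_{m,\beta}(s,k)=\eta_m^{\rm slow}(s,k)-\sigma^{\rm slow}_{m,\beta}(s,k)$$ (an empty sum is zero). *)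

theory Defs
  imports "HOL-Analysis.Analysis" "HOL-Library.Landau_Symbols"
begin

section \<open>Derivatives and smoothness\<close>

text \<open>
  Derivatives are taken within the domain, so that the same notions apply to open sets and to
  sets such as \<open>{a..b} \<times> {0<..}\<close> or the closed exterior of a convex body, on which the
  derivative is still unique.
\<close>

definition dderiv ::
  "'a::real_normed_vector set \<Rightarrow> 'a \<Rightarrow> ('a \<Rightarrow> 'b::real_normed_vector) \<Rightarrow> 'a \<Rightarrow> 'b" where
  "dderiv S v f x = frechet_derivative f (at x within S) v"

primrec Ck_on ::
  "nat \<Rightarrow> 'a::real_normed_vector set \<Rightarrow> ('a \<Rightarrow> 'b::real_normed_vector) \<Rightarrow> bool" where
  "Ck_on 0 S f \<longleftrightarrow> continuous_on S f"
| "Ck_on (Suc n) S f \<longleftrightarrow> f differentiable_on S \<and> (\<forall>v. Ck_on n S (dderiv S v f))"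

definition smooth_on ::
  "'a::real_normed_vector set \<Rightarrow> ('a \<Rightarrow> 'b::real_normed_vector) \<Rightarrow> bool" where
  "smooth_on S f \<longleftrightarrow> (\<forall>n. Ck_on n S f)"

definition nth_deriv :: "nat \<Rightarrow> (real \<Rightarrow> 'b::real_normed_vector) \<Rightarrow> real \<Rightarrow> 'b" where
  "nth_deriv n f = ((\<lambda>g t. vector_derivative g (at t)) ^^ n) f"

definition grad :: "('a::euclidean_space \<Rightarrow> real) \<Rightarrow> 'a \<Rightarrow> 'a" where
  "grad f x = (\<Sum>e\<in>Basis. dderiv UNIV e f x *\<^sub>R e)"

definition laplacian :: "('a::euclidean_space \<Rightarrow> complex) \<Rightarrow> 'a \<Rightarrow> complex" where
  "laplacian f x = (\<Sum>e\<in>Basis. dderiv UNIV e (dderiv UNIV e f) x)"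


section \<open>Symbol classes and asymptotic expansions\<close>

text \<open>
  \<open>mixed_deriv M vs n a\<close> is \<open>D_x^\<beta> D_k^n a\<close> on \<open>M \<times> (0,\<infinity>)\<close>. The multi-index \<open>\<beta>\<close> is given as a
  list \<open>vs\<close> of coordinate directions, with \<open>|\<beta>| = length vs\<close>.
\<close>

definition mixed_deriv ::
  "'a::euclidean_space set \<Rightarrow> 'a list \<Rightarrow> nat \<Rightarrow> ('a \<Rightarrow> real \<Rightarrow> complex) \<Rightarrow> 'a \<Rightarrow> real \<Rightarrow> complex" where
  "mixed_deriv M vs n a x k =
     foldr (\<lambda>v. dderiv (M \<times> {0<..}) (v, 0)) vs
       ((dderiv (M \<times> {0<..}) (0, 1) ^^ n) (case_prod a)) (x, k)"

definition symbol_class ::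
  "real \<Rightarrow> real \<Rightarrow> real \<Rightarrow> 'a::euclidean_space set \<Rightarrow> ('a \<Rightarrow> real \<Rightarrow> complex) \<Rightarrow> bool" where
  "symbol_class \<mu> \<rho> \<delta> M a \<longleftrightarrow>
     smooth_on (M \<times> {0<..}) (case_prod a) \<and>
     (\<forall>W k0 vs n. compact W \<and> W \<subseteq> M \<and> 0 < k0 \<and> set vs \<subseteq> Basis \<longrightarrow>
        (\<exists>C. \<forall>x\<in>W. \<forall>k\<ge>k0. norm (mixed_deriv M vs n a x k)
               \<le> C * (1 + k) powr (\<mu> - \<rho> * real n + \<delta> * real (length vs))))"

text \<open>Local coordinates on a relatively open subset \<open>\<Gamma>\<close> of a smooth curve, as inverse charts.\<close>

definition local_param :: "(real^2) set \<Rightarrow> real set \<Rightarrow> (real \<Rightarrow> real^2) \<Rightarrow> bool" where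
  "local_param \<Gamma> J c \<longleftrightarrow>
     open J \<and> is_interval J \<and> smooth_on J c \<and> inj_on c J \<and>
     (\<forall>s\<in>J. vector_derivative c (at s) \<noteq> 0) \<and> c ` J \<subseteq> \<Gamma>"

definition curve_smooth :: "(real^2) set \<Rightarrow> (real^2 \<Rightarrow> 'b::real_normed_vector) \<Rightarrow> bool" where
  "curve_smooth \<Gamma> f \<longleftrightarrow> (\<forall>J c. local_param \<Gamma> J c \<longrightarrow> smooth_on J (f \<circ> c))"

definition curve_symbol ::
  "real \<Rightarrow> real \<Rightarrow> real \<Rightarrow> (real^2) set \<Rightarrow> (real^2 \<Rightarrow> real \<Rightarrow> complex) \<Rightarrow> bool" where
  "curve_symbol \<mu> \<rho> \<delta> \<Gamma> a \<longleftrightarrow>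
     (\<forall>J c. local_param \<Gamma> J c \<longrightarrow> symbol_class \<mu> \<rho> \<delta> J (\<lambda>s k. a (c s) k))"

definition curve_rapid_decrease :: "(real^2) set \<Rightarrow> (real^2 \<Rightarrow> real \<Rightarrow> complex) \<Rightarrow> bool" where
  "curve_rapid_decrease \<Gamma> a \<longleftrightarrow>
     (\<forall>J c. local_param \<Gamma> J c \<longrightarrow>
        smooth_on (J \<times> {0<..}) (\<lambda>(s, k). a (c s) k) \<and>
        (\<forall>W i n (N::nat). compact W \<and> W \<subseteq> J \<longrightarrow>
           (\<exists>C. \<exists>k0>0. \<forall>s\<in>W. \<forall>k\<ge>k0.
              norm (mixed_deriv J (replicate i 1) n (\<lambda>s k. a (c s) k) s k) \<le> C * k powr (- real N))))"

text \<open>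
  \<open>a \<sim> \<Sum>\<iota>\<in>I. t \<iota>\<close>, where \<open>S \<mu>\<close> is the symbol class of order \<open>\<mu>\<close>. The first conjunct is the
  condition on the family under which the expansion is meaningful.
\<close>

definition asymp_sum ::
  "(real \<Rightarrow> ('x \<Rightarrow> real \<Rightarrow> complex) \<Rightarrow> bool) \<Rightarrow> 'i set \<Rightarrow> ('i \<Rightarrow> 'x \<Rightarrow> real \<Rightarrow> complex)
     \<Rightarrow> ('x \<Rightarrow> real \<Rightarrow> complex) \<Rightarrow> bool" where
  "asymp_sum S I t a \<longleftrightarrow>
     (\<exists>\<mu>. (\<forall>\<iota>\<in>I. S (\<mu> \<iota>) (t \<iota>)) \<and> (\<forall>c. finite {\<iota>\<in>I. \<mu> \<iota> > c})) \<and>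
     (\<forall>N::nat. \<exists>F. finite F \<and> F \<subseteq> I \<and>
        (\<forall>F'. finite F' \<and> F \<subseteq> F' \<and> F' \<subseteq> I \<longrightarrow>
           S (- real N) (\<lambda>x k. a x k - (\<Sum>\<iota>\<in>F'. t \<iota> x k))))"


section \<open>Obstacles\<close>

definition cross2 :: "real^2 \<Rightarrow> real^2 \<Rightarrow> real" where
  "cross2 a b = a $ 1 * b $ 2 - a $ 2 * b $ 1"

text \<open>
  For a convex body with smooth boundary the exterior unit normal is the unique unit vector
  defining a supporting half-plane.
\<close>

definition outer_normal :: "(real^2) set \<Rightarrow> real^2 \<Rightarrow> real^2" where
  "outer_normal K x = (THE n. norm n = 1 \<and> (\<forall>y\<in>K. (y - x) \<bullet> n \<le> 0))"

text \<open>
  The last conjunct is the counterclockwise orientation: the convex set \<open>K\<close> lies to the left of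
  each oriented tangent line.
\<close>

definition ccw_param :: "(real^2) set \<Rightarrow> (real \<Rightarrow> real^2) \<Rightarrow> real \<Rightarrow> bool" where
  "ccw_param K \<gamma> P \<longleftrightarrow>
     0 < P \<and> smooth_on UNIV \<gamma> \<and> (\<forall>s. \<gamma> (s + P) = \<gamma> s) \<and>
     (\<forall>s. vector_derivative \<gamma> (at s) \<noteq> 0) \<and>
     inj_on \<gamma> {0..<P} \<and> \<gamma> ` {0..<P} = frontier K \<and>
     (\<forall>s. \<forall>y\<in>K. 0 \<le> cross2 (vector_derivative \<gamma> (at s)) (y - \<gamma> s))"

definition smooth_strictly_convex_obstacle :: "(real^2) set \<Rightarrow> bool" where
  "smooth_strictly_convex_obstacle K \<longleftrightarrow>
     compact K \<and> interior K \<noteq> {} \<and>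
     (\<forall>x\<in>K. \<forall>y\<in>K. x \<noteq> y \<longrightarrow> open_segment x y \<subseteq> interior K) \<and>
     (\<exists>\<gamma> P. ccw_param K \<gamma> P)"

definition positively_curved :: "(real^2) set \<Rightarrow> bool" where
  "positively_curved K \<longleftrightarrow>
     (\<forall>\<gamma> P s. ccw_param K \<gamma> P \<longrightarrow> 0 < cross2 (nth_deriv 1 \<gamma> s) (nth_deriv 2 \<gamma> s))"

text \<open>
  Illuminated region, shadow boundary and shadow region of \<open>\<partial>K\<close> for the field \<open>d\<close> of
  incidence directions.
\<close>

definition IL :: "(real^2) set \<Rightarrow> (real^2 \<Rightarrow> real^2) \<Rightarrow> (real^2) set" where
  "IL K d = {x \<in> frontier K. d x \<bullet> outer_normal K x < 0}"

definition SB :: "(real^2) set \<Rightarrow> (real^2 \<Rightarrow> real^2) \<Rightarrow> (real^2) set" where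
  "SB K d = {x \<in> frontier K. d x \<bullet> outer_normal K x = 0}"

definition SR :: "(real^2) set \<Rightarrow> (real^2 \<Rightarrow> real^2) \<Rightarrow> (real^2) set" where
  "SR K d = {x \<in> frontier K. d x \<bullet> outer_normal K x > 0}"


section \<open>Scattering problems\<close>

definition helmholtz_on :: "(real^2) set \<Rightarrow> real \<Rightarrow> (real^2 \<Rightarrow> complex) \<Rightarrow> bool" where
  "helmholtz_on U k u \<longleftrightarrow>
     Ck_on 2 U u \<and> (\<forall>x\<in>U. laplacian u x + of_real (k\<^sup>2) * u x = 0)"

text \<open>
  Classical outgoing solution \<open>u\<close>, with its values on \<open>\<partial>K\<close>, of the exterior Neumann problem for the
  incident field \<open>w\<close>. The limit along \<open>at_infinity\<close> is uniform in all directions.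
\<close>

definition outgoing_neumann ::
  "(real^2) set \<Rightarrow> real \<Rightarrow> (real^2 \<Rightarrow> complex) \<Rightarrow> (real^2 \<Rightarrow> complex) \<Rightarrow> bool" where
  "outgoing_neumann K k w u \<longleftrightarrow>
     helmholtz_on (- K) k u \<and> Ck_on 1 (- interior K) u \<and>
     (\<forall>x\<in>frontier K. dderiv (- interior K) (outer_normal K x) u x
                      = - dderiv UNIV (outer_normal K x) w x) \<and>
     ((\<lambda>x. sqrt (norm x) *\<^sub>R (dderiv UNIV (sgn x) u x - \<i> * of_real k * u x)) \<longlongrightarrow> 0) at_infinity"

definition plane_wave :: "real^2 \<Rightarrow> real^2 \<Rightarrow> real \<Rightarrow> complex" where
  "plane_wave \<alpha> x k = exp (\<i> * of_real (k * (\<alpha> \<bullet> x)))"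

definition incident_field ::
  "real^2 \<Rightarrow> (nat \<Rightarrow> real^2 \<Rightarrow> real \<Rightarrow> complex) \<Rightarrow> nat \<Rightarrow> real^2 \<Rightarrow> real \<Rightarrow> complex" where
  "incident_field \<alpha> u m = (case m of 0 \<Rightarrow> plane_wave \<alpha> | Suc j \<Rightarrow> u j)"

definition multiple_scattering ::
  "(nat \<Rightarrow> (real^2) set) \<Rightarrow> real^2 \<Rightarrow> (nat \<Rightarrow> real^2 \<Rightarrow> real \<Rightarrow> complex) \<Rightarrow> bool" where
  "multiple_scattering K \<alpha> u \<longleftrightarrow>
     (\<forall>m. \<forall>k>0. outgoing_neumann (K m) k (\<lambda>x. incident_field \<alpha> u m x k) (\<lambda>x. u m x k))"

definition total_field ::
  "real^2 \<Rightarrow> (nat \<Rightarrow> real^2 \<Rightarrow> real \<Rightarrow> complex) \<Rightarrow> nat \<Rightarrow> real^2 \<Rightarrow> real \<Rightarrow> complex" where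
  "total_field \<alpha> u m x k = u m x k + incident_field \<alpha> u m x k"


section \<open>Broken rays and phases\<close>

definition reflect :: "real^2 \<Rightarrow> real^2 \<Rightarrow> real^2" where
  "reflect n e = e - (2 * (e \<bullet> n)) *\<^sub>R n"

definition is_broken_ray ::
  "(nat \<Rightarrow> (real^2) set) \<Rightarrow> real^2 \<Rightarrow> nat \<Rightarrow> real^2 \<Rightarrow> (nat \<Rightarrow> real^2) \<Rightarrow> bool" where
  "is_broken_ray K \<alpha> m x X \<longleftrightarrow>
     X \<in> (\<Pi>\<^sub>E j\<in>{..m}. frontier (K j)) \<and> X m = x \<and>
     \<alpha> \<bullet> outer_normal (K 0) (X 0) < 0 \<and>
     sgn (X 1 - X 0) = reflect (outer_normal (K 0) (X 0)) \<alpha> \<and>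
     (\<forall>j. 0 < j \<and> j < m \<longrightarrow>
        (X (j + 1) - X j) \<bullet> outer_normal (K j) (X j) > 0 \<and>
        sgn (X (j + 1) - X j) = reflect (outer_normal (K j) (X j)) (sgn (X j - X (j - 1))))"

text \<open>Used for \<open>m \<ge> 1\<close> and \<open>x \<in> \<partial>K\<^sub>m\<close> only, where the broken ray is unique.\<close>

definition broken_ray ::
  "(nat \<Rightarrow> (real^2) set) \<Rightarrow> real^2 \<Rightarrow> nat \<Rightarrow> real^2 \<Rightarrow> nat \<Rightarrow> real^2" where
  "broken_ray K \<alpha> m x = (THE X. is_broken_ray K \<alpha> m x X)"

definition phase :: "(nat \<Rightarrow> (real^2) set) \<Rightarrow> real^2 \<Rightarrow> nat \<Rightarrow> real^2 \<Rightarrow> real" where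
  "phase K \<alpha> m x =
     (if m = 0 then \<alpha> \<bullet> x
      else \<alpha> \<bullet> broken_ray K \<alpha> m x 0
           + (\<Sum>j<m. norm (broken_ray K \<alpha> m x (j + 1) - broken_ray K \<alpha> m x j)))"

definition inc_dir :: "(nat \<Rightarrow> (real^2) set) \<Rightarrow> real^2 \<Rightarrow> nat \<Rightarrow> real^2 \<Rightarrow> real^2" where
  "inc_dir K \<alpha> m x =
     (if m = 0 then \<alpha> else sgn (broken_ray K \<alpha> m x m - broken_ray K \<alpha> m x (m - 1)))"

definition eta_slow ::
  "(nat \<Rightarrow> (real^2) set) \<Rightarrow> real^2 \<Rightarrow> (nat \<Rightarrow> real^2 \<Rightarrow> real \<Rightarrow> complex)
     \<Rightarrow> nat \<Rightarrow> real^2 \<Rightarrow> real \<Rightarrow> complex" where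
  "eta_slow K \<alpha> u m x k = exp (- \<i> * of_real (k * phase K \<alpha> m x)) * total_field \<alpha> u m x k"


section \<open>The expansion of the envelopes\<close>

type_synonym index = "nat \<times> nat \<times> nat \<times> int"

definition indices :: "index set" where
  "indices = {(p, q, r, l). l \<le> -1}"

fun term_order :: "index \<Rightarrow> real" where
  "term_order (p, q, r, l) =
     - (1 + 2 * real p + 3 * real q + real r + of_int l) / 3 + min (of_int l + 1) 0"

fun expansion_term ::
  "(nat \<Rightarrow> int \<Rightarrow> real \<Rightarrow> complex) \<Rightarrow> (index \<Rightarrow> real^2 \<Rightarrow> complex) \<Rightarrow> (real^2 \<Rightarrow> real)
     \<Rightarrow> index \<Rightarrow> real^2 \<Rightarrow> real \<Rightarrow> complex" where
  "expansion_term \<Psi> b Z (p, q, r, l) x k =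
     of_real (k powr term_order (p, q, r, l)) * b (p, q, r, l) x
       * nth_deriv p (\<Psi> r l) (k powr (1/3) * Z x)"

definition shadow_boundary_function ::
  "(real^2) set \<Rightarrow> (real^2 \<Rightarrow> real^2) \<Rightarrow> (real^2 \<Rightarrow> real) \<Rightarrow> bool" where
  "shadow_boundary_function K d Z \<longleftrightarrow>
     curve_smooth (frontier K) Z \<and>
     (\<forall>x\<in>IL K d. 0 < Z x) \<and> (\<forall>x\<in>SR K d. Z x < 0) \<and> (\<forall>x\<in>SB K d. Z x = 0) \<and>
     (\<forall>J c s. local_param (frontier K) J c \<and> s \<in> J \<and> c s \<in> SB K d \<longrightarrow>
        vector_derivative (Z \<circ> c) (at s) \<noteq> 0)"

text \<open>
  \<open>f\<close> is an envelope on \<open>\<partial>K\<close> with incidence directions \<open>d\<close>. The conjuncts after the conditions on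
  \<open>Z\<close> and \<open>b\<close> are: the expansion on all of \<open>\<partial>K\<close>, the one on the illuminated region, and rapid
  decrease on the shadow region.
\<close>

definition envelope_expansion ::
  "(nat \<Rightarrow> int \<Rightarrow> real \<Rightarrow> complex) \<Rightarrow> (real^2) set \<Rightarrow> (real^2 \<Rightarrow> real^2)
     \<Rightarrow> (real^2 \<Rightarrow> real \<Rightarrow> complex) \<Rightarrow> (index \<Rightarrow> real^2 \<Rightarrow> complex) \<Rightarrow> (real^2 \<Rightarrow> real) \<Rightarrow> bool" where
  "envelope_expansion \<Psi> K d f b Z \<longleftrightarrow>
     shadow_boundary_function K d Z \<and> (\<forall>\<iota>\<in>indices. curve_smooth (frontier K) (b \<iota>)) \<and>
     curve_symbol 0 (2/3) (1/3) (frontier K) f \<and>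
     asymp_sum (\<lambda>\<mu>. curve_symbol \<mu> (2/3) (1/3) (frontier K)) indices (expansion_term \<Psi> b Z) f \<and>
     curve_symbol 0 1 0 (IL K d) f \<and>
     (\<exists>a. (\<forall>j::nat. curve_smooth (IL K d) (a j)) \<and>
        asymp_sum (\<lambda>\<mu>. curve_symbol \<mu> 1 0 (IL K d)) UNIV
          (\<lambda>j x k. of_real (k powr (- real j)) * a j x) f) \<and>
     curve_rapid_decrease (SR K d) f"


section \<open>Standing assumptions\<close>

definition assumption_A :: "(nat \<Rightarrow> (real^2) set) \<Rightarrow> real^2 \<Rightarrow> bool" where
  "assumption_A K \<alpha> \<longleftrightarrow>
     (\<forall>m. K (m + 1) \<noteq> K m) \<and>
     {x + t *\<^sub>R \<alpha> | x t. x \<in> K 0 \<and> 0 \<le> t} \<inter> K 1 = {} \<and>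
     (\<forall>m. K (m + 1) \<inter> closure (convex hull (K m \<union> K (m + 2))) = {})"

text \<open>
  The remainder estimates for all derivatives (\<open>n\<close>) express that the expansion at \<open>+\<infinity>\<close> holds in
  the symbol sense.
\<close>

definition transition_family :: "(nat \<Rightarrow> int \<Rightarrow> real \<Rightarrow> complex) \<Rightarrow> bool" where
  "transition_family \<Psi> \<longleftrightarrow>
     (\<forall>r l. l \<le> -1 \<longrightarrow>
        smooth_on UNIV (\<Psi> r l) \<and>
        (\<exists>a. \<forall>J n.
           (\<lambda>\<tau>. norm (nth_deriv n
              (\<lambda>\<tau>. \<Psi> r l \<tau> - (\<Sum>j<J. a j * of_real (\<tau> powi (1 + l - 2 * int r - 3 * int j)))) \<tau>))
           \<in> O[at_top](\<lambda>\<tau>. \<tau> powi (1 + l - 2 * int r - 3 * int J - int n))) \<and>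
        (\<forall>n N. (\<lambda>\<tau>. norm (nth_deriv n (\<Psi> r l) \<tau>)) \<in> O[at_bot](\<lambda>\<tau>. \<bar>\<tau>\<bar> powi (- int N))))"

text \<open>
  A phase solves the eikonal equation; its wave-fronts are convex relative to the normal
  \<open>\<nabla>\<psi>\<close> when their second fundamental form with respect to it, which is the restriction of the Hessian
  to the tangent directions, is nonnegative (as for \<open>\<psi>(x) = |x|\<close>).
\<close>

definition convex_phase_on :: "(real^2) set \<Rightarrow> (real^2 \<Rightarrow> real) \<Rightarrow> bool" where
  "convex_phase_on U \<psi> \<longleftrightarrow>
     smooth_on U \<psi> \<and>
     (\<forall>x\<in>U. norm (grad \<psi> x) = 1 \<and>
        (\<forall>v. v \<bullet> grad \<psi> x = 0 \<longrightarrow> 0 \<le> dderiv UNIV v (dderiv UNIV v \<psi>) x))"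

text \<open>
  The obstacles in this assumption have nonvanishing curvature: expansions of this kind
  break down at points of grazing incidence where the curvature vanishes.
\<close>

definition assumption_B :: "(nat \<Rightarrow> int \<Rightarrow> real \<Rightarrow> complex) \<Rightarrow> bool" where
  "assumption_B \<Psi> \<longleftrightarrow>
     transition_family \<Psi> \<and>
     (\<forall>K U \<psi> w w_slow A u.
        smooth_strictly_convex_obstacle K \<and> positively_curved K \<and> open U \<and> K \<subseteq> U \<and>
        convex_phase_on U \<psi> \<and>
        (\<forall>k>0. helmholtz_on U k (\<lambda>x. w x k)) \<and>
        (\<forall>x\<in>U. \<forall>k>0. w x k = exp (\<i> * of_real (k * \<psi> x)) * w_slow x k) \<and>
        symbol_class 0 1 0 U w_slow \<and>
        (\<forall>p::nat. smooth_on U (A p)) \<and>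
        asymp_sum (\<lambda>\<mu>. symbol_class \<mu> 1 0 U) UNIV
          (\<lambda>p x k. of_real (k powr (- real p)) * A p x) w_slow \<and>
        (\<forall>k>0. outgoing_neumann K k (\<lambda>x. w x k) (\<lambda>x. u x k))
        \<longrightarrow>
        (\<exists>b Z V.
           let f = (\<lambda>x k. exp (- \<i> * of_real (k * \<psi> x)) * (w x k + u x k)) in
           envelope_expansion \<Psi> K (grad \<psi>) f b Z \<and>
           open V \<and> SB K (grad \<psi>) \<subseteq> V \<and>
           curve_symbol 0 (2/3) (1/3) (frontier K \<inter> V) f \<and>
           asymp_sum (\<lambda>\<mu>. curve_symbol \<mu> (2/3) (1/3) (frontier K \<inter> V)) indices
             (expansion_term \<Psi> b Z) f))"


section \<open>The remainders\<close>

definition omega :: "real \<Rightarrow> real \<Rightarrow> real \<Rightarrow> real" where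
  "omega t1 t2 s = (s - t1) * (t2 - s)"

definition W_weight :: "real \<Rightarrow> real \<Rightarrow> real \<Rightarrow> real \<Rightarrow> real" where
  "W_weight t1 t2 s k = k powr (-1/3) + \<bar>omega t1 t2 s\<bar>"

fun theta :: "index \<Rightarrow> real" where
  "theta (p, q, r, l) =
     term_order (p, q, r, l) +
     (if 1 + l - 2 * int r - int p < 0 then 0
      else of_int (1 + l - 2 * int r - int p) / 3)"

definition F_set :: "nat \<Rightarrow> index set" where
  "F_set \<beta> = {\<iota> \<in> indices. real \<beta> + 3 * theta \<iota> > 0}"

lemma finite_F_set: "finite (F_set \<beta>)"
proof -
  have "F_set \<beta> \<subseteq> {..\<beta>} \<times> {..\<beta>} \<times> {..\<beta>} \<times> {- int \<beta> - 1..-1}"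
  proof
    fix \<iota> assume \<iota>: "\<iota> \<in> F_set \<beta>"
    obtain p q r l where eq: "\<iota> = (p, q, r, l)" by (cases \<iota>)
    have l: "l \<le> -1" and pos: "real \<beta> + 3 * theta (p, q, r, l) > 0"
      using \<iota> by (auto simp: F_set_def indices_def eq)
    have "(of_int l :: real) \<le> -1" using l by linarith
    moreover have "3 * theta (p, q, r, l) \<le> 2 - 2 * real p - 3 * real q - real r + 2 * of_int l"
      using l by (auto simp: field_simps min_def)
    ultimately have "2 * real p + 3 * real q + real r - 2 * of_int l < real \<beta> + 2"
      using pos by linarith
    hence "real_of_int (2 * int p + 3 * int q + int r - 2 * l) < real_of_int (int \<beta> + 2)" by simp
    hence "2 * int p + 3 * int q + int r - 2 * l < int \<beta> + 2" by linarith
    thus "\<iota> \<in> {..\<beta>} \<times> {..\<beta>} \<times> {..\<beta>} \<times> {- int \<beta> - 1..-1}" using l by (auto simp: eq)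
  qed
  thus ?thesis by (rule finite_subset) auto
qed

definition sigma_slow ::
  "(nat \<Rightarrow> int \<Rightarrow> real \<Rightarrow> complex) \<Rightarrow> (index \<Rightarrow> real^2 \<Rightarrow> complex) \<Rightarrow> (real^2 \<Rightarrow> real)
     \<Rightarrow> (real \<Rightarrow> real^2) \<Rightarrow> nat \<Rightarrow> real \<Rightarrow> real \<Rightarrow> complex" where
  "sigma_slow \<Psi> b Z \<gamma> \<beta> s k = (\<Sum>\<iota>\<in>F_set \<beta>. expansion_term \<Psi> b Z \<iota> (\<gamma> s) k)"

definition rho_slow ::
  "(nat \<Rightarrow> (real^2) set) \<Rightarrow> real^2 \<Rightarrow> (nat \<Rightarrow> real^2 \<Rightarrow> real \<Rightarrow> complex)
     \<Rightarrow> (nat \<Rightarrow> int \<Rightarrow> real \<Rightarrow> complex) \<Rightarrow> (nat \<Rightarrow> index \<Rightarrow> real^2 \<Rightarrow> complex)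
     \<Rightarrow> (nat \<Rightarrow> real^2 \<Rightarrow> real) \<Rightarrow> (nat \<Rightarrow> real \<Rightarrow> real^2)
     \<Rightarrow> nat \<Rightarrow> nat \<Rightarrow> real \<Rightarrow> real \<Rightarrow> complex" where
  "rho_slow K \<alpha> u \<Psi> b Z \<gamma> m \<beta> s k =
     eta_slow K \<alpha> u m (\<gamma> m s) k - sigma_slow \<Psi> (b m) (Z m) (\<gamma> m) \<beta> s k"

end

theory Submission
  imports Defs "HOL-Library.Periodic_Fun"
begin

text \<open>
  Since \<open>1 + l - 2 r - p \<le> 0\<close> for \<open>l \<le> -1\<close>, the exponent \<open>theta\<close> is just the explicit power of \<open>k\<close>
  in a term of the expansion, and the derivatives of the transition functions satisfy
  \<open>\<Psi>\<^sup>(\<^sup>p\<^sup>+\<^sup>i\<^sup>)(\<tau>) = O((1 + \<bar>\<tau>\<bar>)\<^sup>-\<^sup>i)\<close>. A derivative in \<open>s\<close> that falls on \<open>\<Psi>(k\<^sup>1\<^sup>/\<^sup>3 Z)\<close> costs \<open>k\<^sup>1\<^sup>/\<^sup>3\<close>, but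
  \<open>k\<^sup>1\<^sup>/\<^sup>3 (1 + k\<^sup>1\<^sup>/\<^sup>3 \<bar>Z\<bar>)\<^sup>-\<^sup>1 = (k\<^sup>-\<^sup>1\<^sup>/\<^sup>3 + \<bar>Z\<bar>)\<^sup>-\<^sup>1\<close>, which is \<open>O(1/W)\<close> because \<open>Z\<close> has simple zeros exactly at
  the shadow boundary, where \<open>\<omega>\<close> vanishes. The remainder is the sum of finitely many terms of
  order at most \<open>-\<beta>/3\<close> and of a symbol of order \<open>-N\<close>; for \<open>N = \<beta> + n\<close> the latter absorbs the loss
  \<open>k\<^sup>n\<^sup>/\<^sup>3\<close> in its \<open>n\<close>-th derivative, \<open>W\<close> being bounded.
\<close>

section \<open>Iterated directional derivatives\<close>

text \<open>This is the approach condition under which a Frechet derivative within a set is unique: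
  every point is a limit of points of \<open>S\<close> along each coordinate axis. Being stated axis
  by axis, it passes to products, and it holds for open sets and for nondegenerate closed intervals,
  so it covers both \<open>UNIV\<close> and \<open>{0..P}\<close> times the half-line of
  \<open>k\<close>.\<close>

definition deriv_unique_on :: "'a::euclidean_space set \<Rightarrow> bool" where
  "deriv_unique_on S \<longleftrightarrow>
     (\<forall>x\<in>S. \<forall>i\<in>Basis. \<forall>e>0. \<exists>d. 0 < \<bar>d\<bar> \<and> \<bar>d\<bar> < e \<and> x + d *\<^sub>R i \<in> S)"

lemma deriv_unique_on_open:
  assumes "open S"
  shows "deriv_unique_on S"
  unfolding deriv_unique_on_def
proof (intro ballI allI impI)
  fix x i :: 'a and e :: real
  assume "x \<in> S" and i: "i \<in> Basis" and "e > 0"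
  from assms \<open>x \<in> S\<close> obtain r where "r > 0" and r: "ball x r \<subseteq> S"
    using open_contains_ball by blast
  let ?d = "min r e / 2"
  have "x + ?d *\<^sub>R i \<in> ball x r"
    using i \<open>r > 0\<close> \<open>e > 0\<close> by (auto simp: dist_norm min_def)
  then show "\<exists>d. 0 < \<bar>d\<bar> \<and> \<bar>d\<bar> < e \<and> x + d *\<^sub>R i \<in> S"
    using r \<open>r > 0\<close> \<open>e > 0\<close> by (intro exI[of _ ?d]) auto
qed

lemma deriv_unique_on_Icc:
  fixes a b :: real
  assumes "a < b"
  shows "deriv_unique_on {a..b}"
  unfolding deriv_unique_on_def
proof (intro ballI allI impI)
  fix x i e :: real
  assume x: "x \<in> {a..b}" and i: "i \<in> Basis" and "e > 0"
  show "\<exists>d. 0 < \<bar>d\<bar> \<and> \<bar>d\<bar> < e \<and> x + d *\<^sub>R i \<in> {a..b}"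
  proof (cases "x < b")
    case True
    then show ?thesis
      using x i \<open>e > 0\<close> by (intro exI[of _ "min (b - x) e / 2"]) (auto simp: min_def field_simps)
  next
    case False
    then show ?thesis
      using x i \<open>e > 0\<close> assms
      by (intro exI[of _ "- (min (b - a) e / 2)"]) (auto simp: min_def field_simps)
  qed
qed

lemma deriv_unique_on_Times:
  assumes "deriv_unique_on S" and "deriv_unique_on T"
  shows "deriv_unique_on (S \<times> T)"
  unfolding deriv_unique_on_def
proof (intro ballI allI impI)
  fix x i :: "'a \<times> 'b" and e :: real
  assume x: "x \<in> S \<times> T" and i: "i \<in> Basis" and e: "e > 0"
  from i consider u where "u \<in> Basis" "i = (u, 0)" | v where "v \<in> Basis" "i = (0, v)"
    by (auto simp: Basis_prod_def)
  then show "\<exists>d. 0 < \<bar>d\<bar> \<and> \<bar>d\<bar> < e \<and> x + d *\<^sub>R i \<in> S \<times> T"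
  proof cases
    case 1
    moreover have "fst x \<in> S" using x by auto
    ultimately obtain d where "0 < \<bar>d\<bar> \<and> \<bar>d\<bar> < e \<and> fst x + d *\<^sub>R u \<in> S"
      using assms(1) e unfolding deriv_unique_on_def by blast
    then show ?thesis using 1 x by (intro exI[of _ d]) (auto simp: mem_Times_iff)
  next
    case 2
    moreover have "snd x \<in> T" using x by auto
    ultimately obtain d where "0 < \<bar>d\<bar> \<and> \<bar>d\<bar> < e \<and> snd x + d *\<^sub>R v \<in> T"
      using assms(2) e unfolding deriv_unique_on_def by blast
    then show ?thesis using 2 x by (intro exI[of _ d]) (auto simp: mem_Times_iff)
  qed
qed

section \<open>Algebra of directional derivatives and finite smoothness within a set\<close>

lemma dderiv_eqI:
  assumes "deriv_unique_on S" "x \<in> S" "(f has_derivative f') (at x within S)"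
  shows "dderiv S v f x = f' v"
proof -
  have "(f has_derivative frechet_derivative f (at x within S)) (at x within S)"
    using assms(3) frechet_derivative_works differentiable_def by blast
  then have "frechet_derivative f (at x within S) = f'"
    using assms by (intro frechet_derivative_unique_within[where S = S and x = x and f = f])
      (auto simp: deriv_unique_on_def)
  then show ?thesis by (simp add: dderiv_def)
qed

lemma has_derivative_dderiv:
  assumes "f differentiable_on S" "x \<in> S"
  shows "(f has_derivative (\<lambda>v. dderiv S v f x)) (at x within S)"
  using assms frechet_derivative_works unfolding dderiv_def differentiable_on_def by blast

text \<open>\<open>frechet_derivative\<close> selects an element of the set of derivatives at
  \<open>x\<close> within \<open>S\<close>. That set depends only on the values on \<open>S\<close>,
  so the same selection is made for \<open>f\<close> and for \<open>g\<close>.\<close>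

lemma dderiv_cong:
  assumes "x \<in> S" "\<And>y. y \<in> S \<Longrightarrow> f y = g y"
  shows "dderiv S v f x = dderiv S v g x"
proof -
  have "(f has_derivative D) (at x within S) \<longleftrightarrow> (g has_derivative D) (at x within S)" for D
    using assms has_derivative_transform[of x S f g D] has_derivative_transform[of x S g f D]
    by auto
  then show ?thesis by (simp add: dderiv_def frechet_derivative_def)
qed

lemma Ck_on_cong:
  assumes "\<And>y. y \<in> S \<Longrightarrow> f y = g y"
  shows "Ck_on n S f \<longleftrightarrow> Ck_on n S g"
  using assms
proof (induction n arbitrary: f g)
  case 0
  then show ?case by (simp cong: continuous_on_cong)
next
  case (Suc n)
  have "f differentiable_on S \<longleftrightarrow> g differentiable_on S"
    using Suc.prems unfolding differentiable_on_def differentiable_def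
    by (metis has_derivative_transform)
  moreover have "Ck_on n S (dderiv S v f) \<longleftrightarrow> Ck_on n S (dderiv S v g)" for v
    using Suc.prems by (intro Suc.IH dderiv_cong)
  ultimately show ?case by simp
qed

lemma Ck_on_Suc_imp: "Ck_on (Suc n) S f \<Longrightarrow> Ck_on n S f"
proof (induction n arbitrary: f)
  case 0
  then show ?case by (auto intro: differentiable_imp_continuous_on)
next
  case (Suc n)
  have "f differentiable_on S \<and> (\<forall>v. Ck_on (Suc n) S (dderiv S v f))"
    using Suc.prems by (rule iffD1[OF Ck_on.simps(2)])
  then have "f differentiable_on S \<and> (\<forall>v. Ck_on n S (dderiv S v f))"
    using Suc.IH by blast
  then show ?case by simp
qed

lemma smooth_on_SucD:
  assumes "smooth_on S f"
  shows "f differentiable_on S \<and> (\<forall>v. Ck_on n S (dderiv S v f))"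
proof -
  have "Ck_on (Suc n) S f" using assms by (simp only: smooth_on_def)
  then show ?thesis by (rule iffD1[OF Ck_on.simps(2)])
qed

lemma smooth_on_differentiable: "smooth_on S f \<Longrightarrow> f differentiable_on S"
  using smooth_on_SucD by blast

lemma smooth_on_dderiv: "smooth_on S f \<Longrightarrow> smooth_on S (dderiv S v f)"
  using smooth_on_SucD by (fastforce simp only: smooth_on_def[of S "dderiv S v f"])

lemma smooth_on_continuous: "smooth_on S f \<Longrightarrow> continuous_on S f"
  using smooth_on_differentiable differentiable_imp_continuous_on by blast

lemma smooth_on_has_vector_derivative:
  fixes f :: "real \<Rightarrow> 'b::real_normed_vector"
  assumes "smooth_on UNIV f"
  shows "(f has_vector_derivative dderiv UNIV 1 f s) (at s)"
proof -
  have D: "(f has_derivative (\<lambda>v. dderiv UNIV v f s)) (at s)"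
    using has_derivative_dderiv[OF smooth_on_differentiable[OF assms]] by simp
  have "(\<lambda>v. dderiv UNIV v f s) = (\<lambda>v. v *\<^sub>R dderiv UNIV 1 f s)"
  proof
    show "dderiv UNIV v f s = v *\<^sub>R dderiv UNIV 1 f s" for v
      using linear_cmul[OF has_derivative_linear[OF D], of v 1] by simp
  qed
  then show ?thesis
    unfolding has_vector_derivative_def by (rule has_derivative_eq_rhs[OF D])
qed

lemma dderiv_bilinear:
  assumes "bounded_bilinear pr" "deriv_unique_on S" "x \<in> S"
    and f: "f differentiable_on S" and g: "g differentiable_on S"
  shows "dderiv S v (\<lambda>x. pr (f x) (g x)) x = pr (f x) (dderiv S v g x) + pr (dderiv S v f x) (g x)"
  using assms bounded_bilinear.FDERIV[OF assms(1) has_derivative_dderiv has_derivative_dderiv]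
  by (intro dderiv_eqI) auto

lemma dderiv_add:
  assumes "deriv_unique_on S" "x \<in> S" "f differentiable_on S" "g differentiable_on S"
  shows "dderiv S v (\<lambda>x. f x + g x) x = dderiv S v f x + dderiv S v g x"
  using assms has_derivative_dderiv by (intro dderiv_eqI has_derivative_add) auto

lemma Ck_on_add:
  assumes "deriv_unique_on S" "Ck_on n S f" "Ck_on n S g"
  shows "Ck_on n S (\<lambda>x. f x + g x)"
  using assms(2,3)
proof (induction n arbitrary: f g)
  case 0
  then show ?case by (simp add: continuous_on_add)
next
  case (Suc n)
  have "Ck_on n S (dderiv S v (\<lambda>x. f x + g x))" for v
  proof -
    have "Ck_on n S (\<lambda>x. dderiv S v f x + dderiv S v g x)"
      using Suc by simp
    then show ?thesis
      by (subst Ck_on_cong) (use Suc.prems assms(1) in \<open>auto intro!: dderiv_add\<close>)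
  qed
  then show ?case using Suc.prems by (auto intro: differentiable_on_add)
qed

lemma Ck_on_bilinear:
  assumes pr: "bounded_bilinear pr" and "deriv_unique_on S" "Ck_on n S f" "Ck_on n S g"
  shows "Ck_on n S (\<lambda>x. pr (f x) (g x))"
  using assms(3,4)
proof (induction n arbitrary: f g)
  case 0
  then show ?case using bounded_bilinear.continuous_on[OF pr] by simp
next
  case (Suc n)
  have "Ck_on n S (dderiv S v (\<lambda>x. pr (f x) (g x)))" for v
  proof -
    \<comment> \<open>The Leibniz rule leaves one undifferentiated factor in each product. Lowering
      its class by one makes both products accessible to the induction hypothesis.\<close>
    have "Ck_on n S (\<lambda>x. pr (f x) (dderiv S v g x) + pr (dderiv S v f x) (g x))"
      using Suc.prems Ck_on_Suc_imp[OF Suc.prems(1)] Ck_on_Suc_imp[OF Suc.prems(2)]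
      by (intro Ck_on_add assms Suc.IH) auto
    then show ?thesis
      by (subst Ck_on_cong) (use Suc.prems assms(1,2) in \<open>auto intro!: dderiv_bilinear\<close>)
  qed
  moreover have "(\<lambda>x. pr (f x) (g x)) differentiable_on S"
    using Suc.prems bounded_bilinear.FDERIV[OF pr] 
    unfolding differentiable_on_def differentiable_def Ck_on.simps by blast
  ultimately show ?case by simp
qed

lemma Ck_on_const: "deriv_unique_on S \<Longrightarrow> Ck_on n S (\<lambda>x. c)"
proof (induction n arbitrary: c)
  case (Suc n)
  have "Ck_on n S (dderiv S v (\<lambda>x. c))" for v
    using Suc by (subst Ck_on_cong[where g = "\<lambda>x. 0"]) (auto intro!: dderiv_eqI[where f' = "\<lambda>_. 0"])
  then show ?case by simp
qed simp

lemma smooth_on_add: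
  "deriv_unique_on S \<Longrightarrow> smooth_on S f \<Longrightarrow> smooth_on S g \<Longrightarrow> smooth_on S (\<lambda>x. f x + g x)"
  by (simp add: smooth_on_def Ck_on_add)

lemma smooth_on_bilinear:
  "bounded_bilinear pr \<Longrightarrow> deriv_unique_on S \<Longrightarrow> smooth_on S f \<Longrightarrow> smooth_on S g
    \<Longrightarrow> smooth_on S (\<lambda>x. pr (f x) (g x))"
  by (simp add: smooth_on_def Ck_on_bilinear)

lemma smooth_on_const: "deriv_unique_on S \<Longrightarrow> smooth_on S (\<lambda>x. c)"
  by (simp add: smooth_on_def Ck_on_const)

lemma smooth_on_sum:
  assumes "deriv_unique_on S" "\<And>i. i \<in> I \<Longrightarrow> smooth_on S (f i)"
  shows "smooth_on S (\<lambda>x. \<Sum>i\<in>I. f i x)"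
  using assms(2)
  by (induction I rule: infinite_finite_induct)
     (auto intro!: smooth_on_add smooth_on_const assms(1))

section \<open>Restriction to subsets and gluing along open covers\<close>

lemma dderiv_subset:
  assumes "deriv_unique_on S" "S \<subseteq> T" "x \<in> S" "f differentiable_on T"
  shows "dderiv S v f x = dderiv T v f x"
  using assms has_derivative_dderiv[of f T x]
  by (intro dderiv_eqI) (auto intro: has_derivative_subset)

lemma Ck_on_subset:
  assumes "deriv_unique_on S" "S \<subseteq> T" "Ck_on n T f"
  shows "Ck_on n S f"
  using assms(3)
proof (induction n arbitrary: f)
  case 0
  then show ?case using assms(2) continuous_on_subset by auto
next
  case (Suc n)
  have "Ck_on n S (dderiv S v f)" for v
  proof -
    have "Ck_on n S (dderiv T v f)" using Suc by simp
    then show ?thesis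
      by (subst Ck_on_cong) (use Suc.prems assms in \<open>auto intro!: dderiv_subset\<close>)
  qed
  then show ?case using Suc.prems assms(2) differentiable_on_subset by auto
qed

lemma smooth_on_subset:
  "deriv_unique_on S \<Longrightarrow> S \<subseteq> T \<Longrightarrow> smooth_on T f \<Longrightarrow> smooth_on S f"
  unfolding smooth_on_def using Ck_on_subset by blast

text \<open>Differentiability is local on open sets, and derivatives within a piece agree with
  derivatives within the union. This turns smoothness in charts, which is all that is known on a
  curve, into smoothness on the whole parameter line.\<close>

lemma Ck_on_UN:
  fixes U :: "'i \<Rightarrow> 'a::euclidean_space set"
  assumes "\<And>i. i \<in> I \<Longrightarrow> open (U i)" "\<And>i. i \<in> I \<Longrightarrow> Ck_on n (U i) f"
  shows "Ck_on n (\<Union>i\<in>I. U i) f"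
  using assms(2)
proof (induction n arbitrary: f)
  case 0
  then show ?case using assms(1) by (auto intro!: continuous_on_open_Union)
next
  case (Suc n)
  let ?T = "\<Union>i\<in>I. U i"
  have T: "open ?T" using assms(1) by auto
  have df: "f differentiable_on ?T"
    using Suc.prems assms(1) T by (auto simp: differentiable_on_eq_differentiable_at)
  have "Ck_on n ?T (dderiv ?T v f)" for v
  proof (rule Suc.IH)
    fix i assume i: "i \<in> I"
    have "Ck_on n (U i) (dderiv (U i) v f)" using Suc.prems[OF i] by simp
    moreover have "dderiv (U i) v f x = dderiv ?T v f x" if "x \<in> U i" for x
      using i that assms(1) df by (intro dderiv_subset deriv_unique_on_open) auto
    ultimately show "Ck_on n (U i) (dderiv ?T v f)" by (subst Ck_on_cong) auto
  qed
  then show ?case using df by simp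
qed

lemma smooth_on_UN:
  fixes U :: "'i \<Rightarrow> 'a::euclidean_space set"
  shows "(\<And>i. i \<in> I \<Longrightarrow> open (U i)) \<Longrightarrow> (\<And>i. i \<in> I \<Longrightarrow> smooth_on (U i) f)
    \<Longrightarrow> smooth_on (\<Union>i\<in>I. U i) f"
  by (simp add: smooth_on_def Ck_on_UN)

text \<open>The list is folded from the right, so its last direction acts first. Peeling off the
  last entry differentiates the given function while it is still explicit, which is why later
  inductions run over lists from the end.\<close>

definition iter_dderiv ::
  "'a::real_normed_vector set \<Rightarrow> 'a list \<Rightarrow> ('a \<Rightarrow> 'b::real_normed_vector) \<Rightarrow> 'a \<Rightarrow> 'b" where
  "iter_dderiv S ws = foldr (dderiv S) ws"

lemma iter_dderiv_simps [simp]: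
  "iter_dderiv S [] f = f"
  "iter_dderiv S (w # ws) f = dderiv S w (iter_dderiv S ws f)"
  "iter_dderiv S (ws @ [w]) f = iter_dderiv S ws (dderiv S w f)"
  by (simp_all add: iter_dderiv_def)

lemma mixed_deriv_eq_iter_dderiv:
  "mixed_deriv M vs n a x k =
     iter_dderiv (M \<times> {0<..}) (map (\<lambda>v. (v, 0)) vs @ replicate n (0, 1)) (case_prod a) (x, k)"
  unfolding mixed_deriv_def iter_dderiv_def by (simp add: foldr_map o_def)

lemma iter_dderiv_cong:
  assumes "x \<in> S" "\<And>y. y \<in> S \<Longrightarrow> f y = g y"
  shows "iter_dderiv S ws f x = iter_dderiv S ws g x"
  using assms by (induction ws arbitrary: x) (auto intro!: dderiv_cong)

lemma smooth_on_iter_dderiv: "smooth_on S f \<Longrightarrow> smooth_on S (iter_dderiv S ws f)"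
  by (induction ws) (auto intro: smooth_on_dderiv)

lemma iter_dderiv_add:
  assumes "deriv_unique_on S" "smooth_on S f" "smooth_on S g" "x \<in> S"
  shows "iter_dderiv S ws (\<lambda>x. f x + g x) x = iter_dderiv S ws f x + iter_dderiv S ws g x"
  using assms(4)
proof (induction ws arbitrary: x)
  case (Cons w ws)
  have "dderiv S w (iter_dderiv S ws (\<lambda>x. f x + g x)) x
      = dderiv S w (\<lambda>x. iter_dderiv S ws f x + iter_dderiv S ws g x) x"
    using Cons by (intro dderiv_cong)
  also have "\<dots> = dderiv S w (iter_dderiv S ws f) x + dderiv S w (iter_dderiv S ws g) x"
    using Cons.prems assms
    by (intro dderiv_add smooth_on_differentiable smooth_on_iter_dderiv)
  finally show ?case by simp
qed simp

lemma iter_dderiv_sum: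
  fixes f :: "'i \<Rightarrow> 'a::euclidean_space \<Rightarrow> 'b::real_normed_vector"
  assumes "deriv_unique_on S" "\<And>i. i \<in> I \<Longrightarrow> smooth_on S (f i)" "x \<in> S" "finite I"
  shows "iter_dderiv S ws (\<lambda>x. \<Sum>i\<in>I. f i x) x = (\<Sum>i\<in>I. iter_dderiv S ws (f i) x)"
  using assms(4,2)
proof (induction I rule: finite_induct)
  case empty
  have "iter_dderiv S ws (\<lambda>x. 0) y = (0::'b)" if "y \<in> S" for y
    using that
  proof (induction ws arbitrary: y)
    case (Cons w ws)
    then have "dderiv S w (iter_dderiv S ws (\<lambda>x. 0)) y = dderiv S w (\<lambda>x. 0::'b) y"
      by (intro dderiv_cong)
    also have "\<dots> = 0" using assms(1) Cons.prems by (intro dderiv_eqI[where f' = "\<lambda>_. 0"]) auto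
    finally show ?case by simp
  qed simp
  then show ?case using assms(3) by simp
next
  case (insert i I)
  then show ?case
    using assms(1,3) by (simp add: iter_dderiv_add smooth_on_sum)
qed

lemma iter_dderiv_subset:
  assumes "deriv_unique_on S" "S \<subseteq> T" "smooth_on T f" "x \<in> S"
  shows "iter_dderiv S ws f x = iter_dderiv T ws f x"
  using assms(4)
proof (induction ws arbitrary: x)
  case (Cons w ws)
  have "dderiv S w (iter_dderiv S ws f) x = dderiv S w (iter_dderiv T ws f) x"
    using Cons by (intro dderiv_cong)
  also have "\<dots> = dderiv T w (iter_dderiv T ws f) x"
    using Cons.prems assms
    by (intro dderiv_subset smooth_on_differentiable smooth_on_iter_dderiv)
  finally show ?case by simp
qed simp

section \<open>Transition functions and simple zeros\<close>

lemma nth_deriv_Suc: "nth_deriv (Suc n) f = (\<lambda>t. vector_derivative (nth_deriv n f) (at t))"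
  by (simp add: nth_deriv_def)

lemma smooth_on_nth_deriv:
  fixes f :: "real \<Rightarrow> 'b::real_normed_vector"
  assumes "smooth_on UNIV f"
  shows "smooth_on UNIV (nth_deriv n f)"
proof (induction n)
  case 0
  then show ?case using assms by (simp add: nth_deriv_def)
next
  case (Suc n)
  have "nth_deriv (Suc n) f = dderiv UNIV 1 (nth_deriv n f)"
    using smooth_on_has_vector_derivative[OF Suc]
    by (auto simp: nth_deriv_Suc intro!: vector_derivative_at)
  then show ?case using Suc smooth_on_dderiv by metis
qed

lemma nth_deriv_has_vector_derivative:
  fixes f :: "real \<Rightarrow> 'b::real_normed_vector"
  assumes "smooth_on UNIV f"
  shows "(nth_deriv n f has_vector_derivative nth_deriv (Suc n) f t) (at t)"
  using smooth_on_has_vector_derivative[OF smooth_on_nth_deriv[OF assms]]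
  by (metis nth_deriv_Suc vector_derivative_at)

lemma bounded_if_bounded_outside_compact:
  fixes g :: "real \<Rightarrow> real"
  assumes "continuous_on UNIV g"
    and "\<exists>A. eventually (\<lambda>\<tau>. g \<tau> \<le> A) at_top" and "\<exists>A. eventually (\<lambda>\<tau>. g \<tau> \<le> A) at_bot"
  shows "\<exists>C. \<forall>\<tau>. g \<tau> \<le> C"
proof -
  obtain a b A B where a: "\<And>\<tau>. \<tau> \<ge> a \<Longrightarrow> g \<tau> \<le> A" and b: "\<And>\<tau>. \<tau> \<le> b \<Longrightarrow> g \<tau> \<le> B"
    using assms(2,3) unfolding eventually_at_top_linorder eventually_at_bot_linorder by blast
  have "bounded (g ` {b..a})"
    using assms(1) by (intro compact_imp_bounded compact_continuous_image)
      (auto intro: continuous_on_subset)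
  then obtain D where D: "\<forall>x\<in>g ` {b..a}. norm x \<le> D"
    unfolding bounded_iff by blast
  have "g \<tau> \<le> D" if "\<tau> \<in> {b..a}" for \<tau>
  proof -
    have "\<bar>g \<tau>\<bar> \<le> D" using D that by simp
    then show ?thesis by simp
  qed
  with a b have "g \<tau> \<le> max (max A B) D" for \<tau>
    by (cases "\<tau> \<ge> a"; cases "\<tau> \<le> b") (force simp: le_max_iff_disj)+
  then show ?thesis by blast
qed

text \<open>Only the trivial truncation \<open>J = 0\<close> of the expansion of \<open>\<Psi> r l\<close> at \<open>+\<infinity>\<close> enters, because its
  leading exponent \<open>1 + l - 2 r\<close> is nonpositive.\<close>

lemma transition_family_bound:
  assumes "transition_family \<Psi>" and l: "l \<le> -1"
  shows "\<exists>C. \<forall>\<tau>. norm (nth_deriv n (\<Psi> r l) \<tau>) * (1 + \<bar>\<tau>\<bar>) ^ n \<le> C"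
proof (rule bounded_if_bounded_outside_compact)
  have sm: "smooth_on UNIV (\<Psi> r l)" using assms by (simp add: transition_family_def)
  show "continuous_on UNIV (\<lambda>\<tau>. norm (nth_deriv n (\<Psi> r l) \<tau>) * (1 + \<bar>\<tau>\<bar>) ^ n)"
    by (intro continuous_intros smooth_on_continuous smooth_on_nth_deriv sm)
  \<comment> \<open>For \<open>\<bar>\<tau>\<bar> \<ge> 1\<close> one has
    \<open>1 + \<bar>\<tau>\<bar> \<le> 2 * \<bar>\<tau>\<bar>\<close>; this is the origin of the
    factor \<open>2 ^ n\<close> at both ends of the line.\<close>
  have key: "norm x * (1 + \<bar>\<tau>\<bar>) ^ n \<le> c * 2 ^ n"
    if x: "norm x \<le> c * \<bar>\<tau>\<bar> powi (- int n)" and \<tau>: "\<bar>\<tau>\<bar> \<ge> 1" and "c \<ge> 0" for x :: complex and c \<tau> :: real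
  proof -
    have "(1 + \<bar>\<tau>\<bar>) ^ n \<le> (2 * \<bar>\<tau>\<bar>) ^ n" using \<tau> by (intro power_mono) auto
    then have "norm x * (1 + \<bar>\<tau>\<bar>) ^ n \<le> (c * \<bar>\<tau>\<bar> powi (- int n)) * (2 * \<bar>\<tau>\<bar>) ^ n"
      using x that by (intro mult_mono) auto
    also have "\<dots> = c * 2 ^ n"
      using \<tau> zero_less_abs_iff[of \<tau>] by (auto simp: power_int_minus power_mult_distrib field_simps)
    finally show ?thesis .
  qed
  let ?e = "1 + l - 2 * int r - int n"
  have "\<exists>a. \<forall>J n. (\<lambda>\<tau>. norm (nth_deriv n
              (\<lambda>\<tau>. \<Psi> r l \<tau> - (\<Sum>j<J. a j * of_real (\<tau> powi (1 + l - 2 * int r - 3 * int j)))) \<tau>))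
           \<in> O[at_top](\<lambda>\<tau>. \<tau> powi (1 + l - 2 * int r - 3 * int J - int n))"
    using assms by (simp add: transition_family_def)
  then obtain a where "\<And>J n. (\<lambda>\<tau>. norm (nth_deriv n
              (\<lambda>\<tau>. \<Psi> r l \<tau> - (\<Sum>j<J. a j * of_real (\<tau> powi (1 + l - 2 * int r - 3 * int j)))) \<tau>))
           \<in> O[at_top](\<lambda>\<tau>. \<tau> powi (1 + l - 2 * int r - 3 * int J - int n))"
    by blast
  from this[of n 0] have "(\<lambda>\<tau>. norm (nth_deriv n (\<Psi> r l) \<tau>)) \<in> O[at_top](\<lambda>\<tau>. \<tau> powi ?e)"
    by (simp add: diff_diff_eq)
  then obtain c where c: "c > 0"
    and ev: "eventually (\<lambda>\<tau>. norm (norm (nth_deriv n (\<Psi> r l) \<tau>)) \<le> c * norm (\<tau> powi ?e)) at_top"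
    by (elim landau_o.bigE)
  have "eventually (\<lambda>\<tau>. norm (nth_deriv n (\<Psi> r l) \<tau>) * (1 + \<bar>\<tau>\<bar>) ^ n \<le> c * 2 ^ n) at_top"
    using ev eventually_ge_at_top[of 1]
  proof eventually_elim
    case (elim \<tau>)
    have "\<tau> powi ?e \<le> \<tau> powi (- int n)" using elim l by (intro power_int_increasing) auto
    then have "norm (\<tau> powi ?e) \<le> \<bar>\<tau>\<bar> powi (- int n)" using elim by simp
    then have "c * norm (\<tau> powi ?e) \<le> c * \<bar>\<tau>\<bar> powi (- int n)"
      using c by (intro mult_left_mono) auto
    with elim(1) have "norm (nth_deriv n (\<Psi> r l) \<tau>) \<le> c * \<bar>\<tau>\<bar> powi (- int n)" by simp
    with elim c show ?case by (intro key) auto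
  qed
  then show "\<exists>A. eventually (\<lambda>\<tau>. norm (nth_deriv n (\<Psi> r l) \<tau>) * (1 + \<bar>\<tau>\<bar>) ^ n \<le> A) at_top"
    by blast
  \<comment> \<open>From the rapid decrease at minus infinity only the rate \<open>N = n\<close> is
    taken, enough to cancel the weight.\<close>
  have "(\<lambda>\<tau>. norm (nth_deriv n (\<Psi> r l) \<tau>)) \<in> O[at_bot](\<lambda>\<tau>. \<bar>\<tau>\<bar> powi (- int n))"
    using assms by (simp add: transition_family_def)
  then obtain d where d: "d > 0"
    and ev': "eventually (\<lambda>\<tau>. norm (norm (nth_deriv n (\<Psi> r l) \<tau>)) \<le> d * norm (\<bar>\<tau>\<bar> powi (- int n))) at_bot"
    by (elim landau_o.bigE)
  have "eventually (\<lambda>\<tau>. norm (nth_deriv n (\<Psi> r l) \<tau>) * (1 + \<bar>\<tau>\<bar>) ^ n \<le> d * 2 ^ n) at_bot"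
    using ev' eventually_le_at_bot[of "-1"]
  proof eventually_elim
    case (elim \<tau>)
    have "norm (\<bar>\<tau>\<bar> powi (- int n)) = \<bar>\<tau>\<bar> powi (- int n)"
      unfolding real_norm_def by (intro abs_of_nonneg zero_le_power_int) auto
    with elim(1) have "norm (nth_deriv n (\<Psi> r l) \<tau>) \<le> d * \<bar>\<tau>\<bar> powi (- int n)"
      by (simp only: real_norm_def abs_norm_cancel)
    with elim d show ?case by (intro key) auto
  qed
  then show "\<exists>A. eventually (\<lambda>\<tau>. norm (nth_deriv n (\<Psi> r l) \<tau>) * (1 + \<bar>\<tau>\<bar>) ^ n \<le> A) at_bot"
    by blast
qed

text \<open>The quotient \<open>w / z\<close> has a finite limit at every point of the interval: at
  a zero of \<open>z\<close> it is a quotient of difference quotients whose denominator tends to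
  \<open>z' x\<close>, which is nonzero. It is therefore locally bounded, and compactness makes the
  bound uniform.\<close>

lemma abs_le_const_mult_if_simple_zeros:
  fixes w z :: "real \<Rightarrow> real"
  assumes "a \<le> b"
    and w: "\<And>s. (w has_real_derivative w' s) (at s)"
    and z: "\<And>s. (z has_real_derivative z' s) (at s)"
    and zero: "\<And>s. s \<in> {a..b} \<Longrightarrow> z s = 0 \<Longrightarrow> z' s \<noteq> 0 \<and> w s = 0"
  shows "\<exists>C. \<forall>s\<in>{a..b}. \<bar>w s\<bar> \<le> C * \<bar>z s\<bar>"
proof -
  have ex: "\<exists>C\<ge>0. \<forall>\<^sub>F s in at x. \<bar>w s\<bar> \<le> C * \<bar>z s\<bar>" if x: "x \<in> {a..b}" for x
  proof -
    have "\<exists>L. ((\<lambda>s. w s / z s) \<longlongrightarrow> L) (at x) \<and> (\<forall>\<^sub>F s in at x. z s \<noteq> 0)"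
    proof (cases "z x = 0")
      case True
      have q: "((\<lambda>s. z s / (s - x)) \<longlongrightarrow> z' x) (at x)" "((\<lambda>s. w s / (s - x)) \<longlongrightarrow> w' x) (at x)"
        using z[of x] w[of x] zero[OF x] True by (simp_all add: has_field_derivative_iff)
      \<comment> \<open>Since \<open>w\<close> and \<open>z\<close> both vanish at \<open>x\<close>,
        these are their difference quotients; away from \<open>x\<close> the factors
        \<open>s - x\<close> cancel.\<close>
      have "((\<lambda>s. (w s / (s - x)) / (z s / (s - x))) \<longlongrightarrow> w' x / z' x) (at x)"
        using q zero[OF x True] by (intro tendsto_divide) auto
      moreover have "\<forall>\<^sub>F s in at x. (w s / (s - x)) / (z s / (s - x)) = w s / z s"
        by (auto simp: eventually_at_filter)
      ultimately have "((\<lambda>s. w s / z s) \<longlongrightarrow> w' x / z' x) (at x)"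
        by (rule Lim_transform_eventually)
      moreover have "\<forall>\<^sub>F s in at x. z s / (s - x) \<noteq> 0"
        using q zero[OF x True] by (intro tendsto_imp_eventually_ne) auto
      then have "\<forall>\<^sub>F s in at x. z s \<noteq> 0" by eventually_elim auto
      ultimately show ?thesis by blast
    next
      case False
      have "isCont z x" "isCont w x" using z w DERIV_isCont by blast+
      then have "(z \<longlongrightarrow> z x) (at x)" "(w \<longlongrightarrow> w x) (at x)" by (simp_all add: isCont_def)
      then show ?thesis using False
        by (auto intro!: exI[of _ "w x / z x"] tendsto_divide tendsto_imp_eventually_ne)
    qed
    then obtain L where L: "((\<lambda>s. w s / z s) \<longlongrightarrow> L) (at x)" and nz: "\<forall>\<^sub>F s in at x. z s \<noteq> 0"
      by blast
    have "((\<lambda>s. \<bar>w s / z s\<bar>) \<longlongrightarrow> \<bar>L\<bar>) (at x)" using L by (rule tendsto_rabs)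
    then have "\<forall>\<^sub>F s in at x. \<bar>w s / z s\<bar> < \<bar>L\<bar> + 1" by (rule order_tendstoD) simp
    with nz have "\<forall>\<^sub>F s in at x. \<bar>w s\<bar> \<le> (\<bar>L\<bar> + 1) * \<bar>z s\<bar>"
      by eventually_elim (simp add: abs_divide field_simps)
    then show ?thesis by (intro exI[of _ "\<bar>L\<bar> + 1"]) auto
  qed
  define Q where "Q c d \<longleftrightarrow> (\<exists>C. \<forall>s\<in>{c..d} \<inter> {a..b}. \<bar>w s\<bar> \<le> C * \<bar>z s\<bar>)" for c d
  \<comment> \<open>Bisection replaces an explicit finite subcover: bounds on adjacent intervals
    combine by taking the larger constant, and every point has a neighbourhood with a bound.\<close>
  have "Q a b" using assms(1)
  proof (induction rule: Bolzano)
    case (trans c d e)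
    then obtain C D where "\<forall>s\<in>{c..d} \<inter> {a..b}. \<bar>w s\<bar> \<le> C * \<bar>z s\<bar>"
      and "\<forall>s\<in>{d..e} \<inter> {a..b}. \<bar>w s\<bar> \<le> D * \<bar>z s\<bar>" unfolding Q_def by blast
    then have "\<bar>w s\<bar> \<le> max C D * \<bar>z s\<bar>" if "s \<in> {c..e} \<inter> {a..b}" for s
    proof -
      have "\<bar>w s\<bar> \<le> C * \<bar>z s\<bar> \<or> \<bar>w s\<bar> \<le> D * \<bar>z s\<bar>"
        using that \<open>\<forall>s\<in>{c..d} \<inter> {a..b}. _\<close> \<open>\<forall>s\<in>{d..e} \<inter> {a..b}. _\<close> by (cases "s \<le> d") simp_all
      moreover have "C * \<bar>z s\<bar> \<le> max C D * \<bar>z s\<bar>" "D * \<bar>z s\<bar> \<le> max C D * \<bar>z s\<bar>"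
        by (auto intro: mult_right_mono)
      ultimately show ?thesis by linarith
    qed
    then show ?case unfolding Q_def by blast
  next
    case (local x)
    then obtain C where C: "C \<ge> 0" and "\<forall>\<^sub>F s in at x. \<bar>w s\<bar> \<le> C * \<bar>z s\<bar>" using ex by auto
    then obtain \<delta> where "\<delta> > 0"
      and \<delta>: "\<And>s. s \<noteq> x \<Longrightarrow> dist s x < \<delta> \<Longrightarrow> \<bar>w s\<bar> \<le> C * \<bar>z s\<bar>"
      unfolding eventually_at by blast
    \<comment> \<open>The filter \<open>at x\<close> says nothing about \<open>x\<close> itself, so
      the constant is enlarged to cover that point. If \<open>z x = 0\<close> then
      \<open>w x = 0\<close> as well, and any constant serves there.\<close>
    define D where "D = max C (\<bar>w x\<bar> / \<bar>z x\<bar>)"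
    have "\<bar>w x\<bar> \<le> D * \<bar>z x\<bar>"
    proof (cases "z x = 0")
      case True
      then show ?thesis using zero local by simp
    next
      case False
      then show ?thesis unfolding D_def using mult_right_mono[of "\<bar>w x\<bar> / \<bar>z x\<bar>" D "\<bar>z x\<bar>"]
        by (simp add: D_def)
    qed
    moreover have "\<bar>w s\<bar> \<le> D * \<bar>z s\<bar>" if "s \<noteq> x" "dist s x < \<delta>" for s
      using \<delta>[OF that] mult_right_mono[of C D "\<bar>z s\<bar>"] by (simp add: D_def)
    ultimately have "\<bar>w s\<bar> \<le> D * \<bar>z s\<bar>" if "dist s x < \<delta>" for s using that by metis
    then have "Q c d" if "c \<le> x" "x \<le> d" "d - c < \<delta>" for c d
      using that unfolding Q_def by (intro exI[of _ D]) (auto simp: dist_real_def)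
    then show ?case using \<open>\<delta> > 0\<close> by blast
  qed
  then show ?thesis unfolding Q_def by simp
qed

section \<open>Derivatives of transition terms\<close>

text \<open>Symbol estimates are phrased in powers of \<open>1 + k\<close>, the terms of the
  expansion in powers of \<open>k\<close>. For negative exponents the two are comparable only away
  from \<open>k = 0\<close>, through \<open>k \<ge> k0 / (1 + k0) * (1 + k)\<close>.\<close>

lemma powr_le_one_plus_powr:
  fixes k0 \<nu> :: real
  assumes "k0 > 0"
  shows "\<exists>C\<ge>0. \<forall>k\<ge>k0. k powr \<nu> \<le> C * (1 + k) powr \<nu>"
proof (cases "\<nu> \<ge> 0")
  case True
  then show ?thesis using assms by (intro exI[of _ 1]) (auto intro!: powr_mono2)
next
  case False
  let ?c = "k0 / (1 + k0)"
  have "k powr \<nu> \<le> ?c powr \<nu> * (1 + k) powr \<nu>" if "k \<ge> k0" for k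
  proof -
    have "?c * (1 + k) \<le> k" using that assms by (simp add: field_simps)
    then have "k powr \<nu> \<le> (?c * (1 + k)) powr \<nu>"
      using False that assms by (intro powr_mono2') auto
    then show ?thesis using that assms by (subst (asm) powr_mult) auto
  qed
  then show ?thesis by (intro exI[of _ "?c powr \<nu>"]) auto
qed

lemma compact_norm_bound:
  fixes B :: "real \<Rightarrow> 'b::real_normed_vector"
  assumes "smooth_on UNIV B" "compact W"
  obtains M where "M \<ge> 0" "\<And>s. s \<in> W \<Longrightarrow> norm (B s) \<le> M"
proof -
  have "bounded (B ` W)"
    using assms smooth_on_continuous continuous_on_subset
    by (blast intro: compact_imp_bounded compact_continuous_image)
  then obtain M where "M > 0" "\<forall>x\<in>B ` W. norm x \<le> M" unfolding bounded_pos by blast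
  then show ?thesis by (intro that[of M]) auto
qed

abbreviation half_plane :: "(real \<times> real) set" where
  "half_plane \<equiv> UNIV \<times> {0<..}"

lemma open_half_plane: "open half_plane"
  by (intro open_Times) auto

lemma deriv_unique_on_half_plane: "deriv_unique_on half_plane"
  by (rule deriv_unique_on_open[OF open_half_plane])

text \<open>The locale records what the estimates use of a transition function: a chain of
  successive derivatives whose \<open>i\<close>-th member decays like
  \<open>(1 + \<bar>\<tau>\<bar>)\<close> to the power \<open>-i\<close>. In the application
  \<open>\<Phi> i\<close> is the derivative of order \<open>p + i\<close> of
  \<open>\<Psi> r l\<close>, and \<open>z\<close> is the shadow boundary function along the
  parameterization.\<close>

locale transition_terms =
  fixes \<Phi> :: "nat \<Rightarrow> real \<Rightarrow> complex" and z :: "real \<Rightarrow> real"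
  assumes \<Phi>_deriv: "\<And>i \<tau>. (\<Phi> i has_vector_derivative \<Phi> (Suc i) \<tau>) (at \<tau>)"
    and \<Phi>_bound: "\<And>i. \<exists>C. \<forall>\<tau>. norm (\<Phi> i \<tau>) * (1 + \<bar>\<tau>\<bar>) ^ i \<le> C"
    and z_smooth: "smooth_on UNIV z"
begin

definition trans_term :: "real \<Rightarrow> (real \<Rightarrow> complex) \<Rightarrow> nat \<Rightarrow> real \<times> real \<Rightarrow> complex" where
  "trans_term \<nu> B i = (\<lambda>(s, k). (k powr \<nu>) *\<^sub>R (B s * \<Phi> i (k powr (1/3) * z s)))"

text \<open>Terms of this shape are closed under both partial derivatives, up to sums of two.\<close>

definition s_deriv :: "real \<Rightarrow> (real \<Rightarrow> complex) \<Rightarrow> nat \<Rightarrow> real \<times> real \<Rightarrow> complex" where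
  "s_deriv \<nu> B i = (\<lambda>x. trans_term \<nu> (dderiv UNIV 1 B) i x
     + trans_term (\<nu> + 1/3) (\<lambda>s. dderiv UNIV 1 z s *\<^sub>R B s) (Suc i) x)"

definition k_deriv :: "real \<Rightarrow> (real \<Rightarrow> complex) \<Rightarrow> nat \<Rightarrow> real \<times> real \<Rightarrow> complex" where
  "k_deriv \<nu> B i = (\<lambda>x. trans_term (\<nu> - 1) (\<lambda>s. \<nu> *\<^sub>R B s) i x
     + trans_term (\<nu> - 2/3) (\<lambda>s. (1/3) *\<^sub>R z s *\<^sub>R B s) (Suc i) x)"

text \<open>Directional derivatives are read off from a Frechet derivative, so partial derivatives
  alone would not suffice. The product and chain rules give the total derivative, and
  \<open>s_deriv\<close> and \<open>k_deriv\<close> are its two components.\<close>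

lemma trans_term_has_derivative:
  assumes B: "smooth_on UNIV B" and k: "k > 0"
  shows "(trans_term \<nu> B i has_derivative
     (\<lambda>h. fst h *\<^sub>R s_deriv \<nu> B i (s, k) + snd h *\<^sub>R k_deriv \<nu> B i (s, k))) (at (s, k))"
proof -
  let ?B' = "dderiv UNIV 1 B s" and ?z' = "dderiv UNIV 1 z s" and ?c = "k powr (1/3)"
  have p: "((\<lambda>x. snd x powr \<mu>) has_derivative (\<lambda>h. snd h * (k powr \<mu> * \<mu> / k))) (at (s, k))" for \<mu> :: real
    using k by (auto intro!: derivative_eq_intros simp: field_simps)
  have fst: "(fst has_derivative fst) (at (s, k))"
    by (rule bounded_linear_imp_has_derivative[OF bounded_linear_fst])
  have "((\<lambda>x. B (fst x)) has_derivative (\<lambda>h. fst h *\<^sub>R ?B')) (at (s, k))"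
    using has_derivative_compose[OF fst, of B "\<lambda>h. h *\<^sub>R ?B'"]
      smooth_on_has_vector_derivative[OF B, of s] by (simp add: has_vector_derivative_def)
  moreover have zd: "((\<lambda>x. z (fst x)) has_derivative (\<lambda>h. fst h *\<^sub>R ?z')) (at (s, k))"
    using has_derivative_compose[OF fst, of z "\<lambda>h. h *\<^sub>R ?z'"]
      smooth_on_has_vector_derivative[OF z_smooth, of s] by (simp add: has_vector_derivative_def)
  have "((\<lambda>x. \<Phi> i (snd x powr (1/3) * z (fst x))) has_derivative
      (\<lambda>h. (?c * (fst h *\<^sub>R ?z') + snd h * (?c * (1/3) / k) * z s) *\<^sub>R \<Phi> (Suc i) (?c * z s))) (at (s, k))"
    using \<Phi>_deriv[of i "?c * z s"] has_derivative_mult[OF p[of "1/3"] zd] unfolding has_vector_derivative_def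
    by (intro has_derivative_compose[where g = "\<Phi> i" and f = "\<lambda>x. snd x powr (1/3) * z (fst x)" and x = "(s, k)"])
      auto
  ultimately have D: "((\<lambda>x. (snd x powr \<nu>) *\<^sub>R (B (fst x) * \<Phi> i (snd x powr (1/3) * z (fst x)))) has_derivative
     (\<lambda>h. (k powr \<nu>) *\<^sub>R (B s * ((?c * (fst h *\<^sub>R ?z') + snd h * (?c * (1/3) / k) * z s) *\<^sub>R \<Phi> (Suc i) (?c * z s))
        + (fst h *\<^sub>R ?B') * \<Phi> i (?c * z s)) + (snd h * (k powr \<nu> * \<nu> / k)) *\<^sub>R (B s * \<Phi> i (?c * z s)))) (at (s, k))"
    using has_derivative_scaleR[OF p[of \<nu>] has_derivative_mult] by fastforce
  have e1: "k powr (\<nu> + 1/3) = k powr \<nu> * ?c" and e2: "k powr (\<nu> - 1) = k powr \<nu> / k"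
    using k by (simp_all add: powr_add powr_diff)
  \<comment> \<open>The exponent comes from differentiating \<open>k powr (1/3)\<close> in
    \<open>k\<close>, which multiplies the term by \<open>k powr (1/3) / (3 * k)\<close>.\<close>
  have "k powr (\<nu> - 2/3) = k powr (\<nu> + 1/3 - 1)" by (simp add: algebra_simps)
  then have e3: "k powr (\<nu> - 2/3) = k powr \<nu> * ?c / k"
    using k e1 by (simp only: powr_diff) simp
  show ?thesis
    unfolding trans_term_def case_prod_unfold s_deriv_def k_deriv_def
    by (rule has_derivative_eq_rhs[OF D])
       (simp add: fun_eq_iff e1 e2 e3 scaleR_conv_of_real algebra_simps add_divide_distrib)
qed

lemma dderiv_trans_term:
  assumes "smooth_on UNIV B" "x \<in> half_plane"
  shows "dderiv half_plane v (trans_term \<nu> B i) x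
    = fst v *\<^sub>R s_deriv \<nu> B i x + snd v *\<^sub>R k_deriv \<nu> B i x"
  using assms trans_term_has_derivative[of B "snd x" \<nu> i "fst x"]
  by (intro dderiv_eqI deriv_unique_on_half_plane) (auto intro: has_derivative_at_withinI)

lemmas smooth_on_line = smooth_on_bilinear[OF bounded_bilinear_scaleR deriv_unique_on_open[OF open_UNIV]]

lemma smooth_on_coeffs:
  assumes "smooth_on UNIV B"
  shows "smooth_on UNIV (dderiv UNIV 1 B)" "smooth_on UNIV (\<lambda>s. dderiv UNIV 1 z s *\<^sub>R B s)"
    "smooth_on UNIV (\<lambda>s. c *\<^sub>R B s)" "smooth_on UNIV (\<lambda>s. c *\<^sub>R z s *\<^sub>R B s)"
  by (intro smooth_on_line smooth_on_dderiv assms z_smooth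
      smooth_on_const[OF deriv_unique_on_open[OF open_UNIV]])+

lemma differentiable_on_trans_term:
  assumes "smooth_on UNIV B"
  shows "trans_term \<nu> B i differentiable_on half_plane"
proof (rule differentiable_at_imp_differentiable_on)
  fix x assume "x \<in> half_plane"
  then have "snd x > 0" by auto
  from trans_term_has_derivative[OF assms this, of \<nu> i "fst x"]
  show "trans_term \<nu> B i differentiable at x" by (auto simp: differentiable_def)
qed

text \<open>The induction generalizes the exponent, the coefficient and the order \<open>i\<close>,
  because a derivative is a combination of terms of the same shape with these three data
  changed.\<close>

lemma Ck_on_trans_term:
  assumes "smooth_on UNIV B"
  shows "Ck_on n half_plane (trans_term \<nu> B i)"
  using assms
proof (induction n arbitrary: \<nu> B i)
  case 0
  then show ?case
    by (simp add: differentiable_imp_continuous_on differentiable_on_trans_term)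
next
  case (Suc n)
  have "Ck_on n half_plane (dderiv half_plane v (trans_term \<nu> B i))" for v
  proof -
    have "Ck_on n half_plane (s_deriv \<nu> B i)" "Ck_on n half_plane (k_deriv \<nu> B i)"
      unfolding s_deriv_def k_deriv_def
      by (intro Ck_on_add deriv_unique_on_half_plane Suc.IH smooth_on_coeffs Suc.prems)+
    then have "Ck_on n half_plane (\<lambda>x. fst v *\<^sub>R s_deriv \<nu> B i x + snd v *\<^sub>R k_deriv \<nu> B i x)"
      by (intro Ck_on_add Ck_on_bilinear[OF bounded_bilinear_scaleR] Ck_on_const deriv_unique_on_half_plane)
    then show ?thesis
      by (subst Ck_on_cong) (use Suc.prems in \<open>auto intro!: dderiv_trans_term\<close>)
  qed
  then show ?case using Suc.prems by (simp add: differentiable_on_trans_term)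
qed

lemma smooth_on_trans_term: "smooth_on UNIV B \<Longrightarrow> smooth_on half_plane (trans_term \<nu> B i)"
  by (simp add: smooth_on_def Ck_on_trans_term)

section \<open>Estimates for iterated derivatives of transition terms\<close>

lemma iter_dderiv_trans_term_s:
  assumes "smooth_on UNIV B" "x \<in> half_plane"
  shows "iter_dderiv half_plane (ws @ [(1, 0)]) (trans_term \<nu> B i) x
    = iter_dderiv half_plane ws (trans_term \<nu> (dderiv UNIV 1 B) i) x
    + iter_dderiv half_plane ws (trans_term (\<nu> + 1/3) (\<lambda>s. dderiv UNIV 1 z s *\<^sub>R B s) (Suc i)) x"
proof -
  have "iter_dderiv half_plane (ws @ [(1, 0)]) (trans_term \<nu> B i) x
      = iter_dderiv half_plane ws (s_deriv \<nu> B i) x"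
    using assms by (simp, intro iter_dderiv_cong) (simp_all add: dderiv_trans_term)
  then show ?thesis
    unfolding s_deriv_def using assms
    by (simp add: iter_dderiv_add deriv_unique_on_half_plane smooth_on_trans_term smooth_on_coeffs)
qed

lemma iter_dderiv_trans_term_k:
  assumes "smooth_on UNIV B" "x \<in> half_plane"
  shows "iter_dderiv half_plane (ws @ [(0, 1)]) (trans_term \<nu> B i) x
    = iter_dderiv half_plane ws (trans_term (\<nu> - 1) (\<lambda>s. \<nu> *\<^sub>R B s) i) x
    + iter_dderiv half_plane ws (trans_term (\<nu> - 2/3) (\<lambda>s. (1/3) *\<^sub>R z s *\<^sub>R B s) (Suc i)) x"
proof -
  have "iter_dderiv half_plane (ws @ [(0, 1)]) (trans_term \<nu> B i) x
      = iter_dderiv half_plane ws (k_deriv \<nu> B i) x"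
    using assms by (simp, intro iter_dderiv_cong) (simp_all add: dderiv_trans_term)
  moreover have "smooth_on UNIV (\<lambda>s. \<nu> *\<^sub>R B s)" "smooth_on UNIV (\<lambda>s. (1/3) *\<^sub>R z s *\<^sub>R B s)"
    by (intro smooth_on_coeffs assms)+
  ultimately show ?thesis
    unfolding k_deriv_def using assms
    by (simp only: iter_dderiv_add deriv_unique_on_half_plane smooth_on_trans_term)
qed

text \<open>A derivative in \<open>s\<close> raises the power of \<open>k\<close> by at most 1/3,
  and a derivative in \<open>k\<close> lowers it by at least 2/3; the sum over \<open>ws\<close>
  keeps this account. The functions \<open>\<Phi> i\<close> enter only through their
  boundedness.\<close>

lemma trans_term_symbol_bound:
  assumes "smooth_on UNIV B" "set ws \<subseteq> {(1, 0), (0, 1)}" "compact W" "k0 > 0"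
  shows "\<exists>C\<ge>0. \<forall>s\<in>W. \<forall>k\<ge>k0. norm (iter_dderiv half_plane ws (trans_term \<nu> B i) (s, k))
      \<le> C * (1 + k) powr (\<nu> + (\<Sum>w\<leftarrow>ws. fst w / 3 - 2 / 3 * snd w))"
  using assms(1,2)
proof (induction ws arbitrary: \<nu> B i rule: rev_induct)
  case Nil
  obtain M where M: "M \<ge> 0" "\<And>s. s \<in> W \<Longrightarrow> norm (B s) \<le> M"
    using compact_norm_bound Nil assms(3) by blast
  obtain C where C: "\<And>\<tau>. norm (\<Phi> i \<tau>) * (1 + \<bar>\<tau>\<bar>) ^ i \<le> C" using \<Phi>_bound by blast
  \<comment> \<open>The weight \<open>(1 + \<bar>\<tau>\<bar>) ^ i\<close> is at least 1, so the
    decay estimate contains a uniform bound.\<close>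
  have \<Phi>: "norm (\<Phi> i \<tau>) \<le> C" for \<tau>
    using C[of \<tau>] mult_left_mono[of 1 "(1 + \<bar>\<tau>\<bar>) ^ i" "norm (\<Phi> i \<tau>)"] by simp
  then have "C \<ge> 0" using norm_ge_zero order_trans by blast
  obtain D where D: "D \<ge> 0" "\<And>k. k \<ge> k0 \<Longrightarrow> k powr \<nu> \<le> D * (1 + k) powr \<nu>"
    using powr_le_one_plus_powr[OF assms(4)] by blast
  have "norm (trans_term \<nu> B i (s, k)) \<le> (D * (1 + k) powr \<nu>) * (M * C)" if "s \<in> W" "k \<ge> k0" for s k
    using that M D \<Phi> \<open>C \<ge> 0\<close> unfolding trans_term_def
    by (auto simp: norm_mult intro!: mult_mono)
  then show ?case
    using M D \<open>C \<ge> 0\<close> by (intro exI[of _ "D * (M * C)"]) (auto simp: mult_ac)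
next
  case (snoc w ws)
  let ?e = "\<lambda>\<nu>. \<nu> + (\<Sum>w\<leftarrow>ws. fst w / 3 - 2 / 3 * snd w)"
  let ?e' = "\<nu> + (\<Sum>w\<leftarrow>ws @ [w]. fst w / 3 - 2 / 3 * snd w)"
  \<comment> \<open>Both directions are brought to one form, a sum of two terms with one derivative
    fewer and admissible exponents, so that the estimate below is made once.\<close>
  have "\<exists>\<nu>1 \<nu>2 B1 B2 i1 i2. smooth_on UNIV B1 \<and> smooth_on UNIV B2 \<and> ?e \<nu>1 \<le> ?e' \<and> ?e \<nu>2 \<le> ?e' \<and>
     (\<forall>x\<in>half_plane. iter_dderiv half_plane (ws @ [w]) (trans_term \<nu> B i) x
        = iter_dderiv half_plane ws (trans_term \<nu>1 B1 i1) x
        + iter_dderiv half_plane ws (trans_term \<nu>2 B2 i2) x)"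
  proof (cases "w = (1, 0)")
    case True
    show ?thesis
      unfolding True using iter_dderiv_trans_term_s[OF snoc.prems(1)] smooth_on_coeffs(1,2)[OF snoc.prems(1)]
      by (intro exI[of _ \<nu>] exI[of _ "\<nu> + 1/3"] exI[of _ "dderiv UNIV 1 B"]
           exI[of _ "\<lambda>s. dderiv UNIV 1 z s *\<^sub>R B s"] exI[of _ i] exI[of _ "Suc i"])
         (simp del: iter_dderiv_simps)
  next
    case False
    then have w: "w = (0, 1)" using snoc.prems by auto
    show ?thesis
      unfolding w
      by (intro exI[of _ "\<nu> - 1"] exI[of _ "\<nu> - 2/3"] exI[of _ "\<lambda>s. \<nu> *\<^sub>R B s"]
           exI[of _ "\<lambda>s. (1/3) *\<^sub>R z s *\<^sub>R B s"] exI[of _ i] exI[of _ "Suc i"] conjI ballI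
           iter_dderiv_trans_term_k[OF snoc.prems(1)] smooth_on_coeffs(4)[OF snoc.prems(1)]
           smooth_on_coeffs(3)[OF snoc.prems(1)]) simp_all
  qed
  then obtain \<nu>1 \<nu>2 B1 B2 i1 i2 where B12: "smooth_on UNIV B1" "smooth_on UNIV B2"
    and e: "?e \<nu>1 \<le> ?e'" "?e \<nu>2 \<le> ?e'"
    and eq: "\<And>x. x \<in> half_plane \<Longrightarrow> iter_dderiv half_plane (ws @ [w]) (trans_term \<nu> B i) x
        = iter_dderiv half_plane ws (trans_term \<nu>1 B1 i1) x
        + iter_dderiv half_plane ws (trans_term \<nu>2 B2 i2) x" by blast
  have ws: "set ws \<subseteq> {(1, 0), (0, 1)}" using snoc.prems by auto
  obtain C1 where C1: "C1 \<ge> 0" "\<And>s k. s \<in> W \<Longrightarrow> k \<ge> k0 \<Longrightarrow>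
      norm (iter_dderiv half_plane ws (trans_term \<nu>1 B1 i1) (s, k)) \<le> C1 * (1 + k) powr ?e \<nu>1"
    using snoc.IH[OF B12(1) ws] by blast
  obtain C2 where C2: "C2 \<ge> 0" "\<And>s k. s \<in> W \<Longrightarrow> k \<ge> k0 \<Longrightarrow>
      norm (iter_dderiv half_plane ws (trans_term \<nu>2 B2 i2) (s, k)) \<le> C2 * (1 + k) powr ?e \<nu>2"
    using snoc.IH[OF B12(2) ws] by blast
  have "norm (iter_dderiv half_plane (ws @ [w]) (trans_term \<nu> B i) (s, k)) \<le> (C1 + C2) * (1 + k) powr ?e'"
    if "s \<in> W" "k \<ge> k0" for s k
  proof -
    have "(1 + k) powr ?e \<nu>1 \<le> (1 + k) powr ?e'" "(1 + k) powr ?e \<nu>2 \<le> (1 + k) powr ?e'"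
      using e that assms(4) by (intro powr_mono; simp)+
    then have "C1 * (1 + k) powr ?e \<nu>1 \<le> C1 * (1 + k) powr ?e'"
      "C2 * (1 + k) powr ?e \<nu>2 \<le> C2 * (1 + k) powr ?e'"
      using C1(1) C2(1) by (auto intro: mult_left_mono)
    moreover have "(s, k) \<in> half_plane" using that assms(4) by simp
    ultimately show ?thesis
      unfolding eq[OF \<open>(s, k) \<in> half_plane\<close>] distrib_right
      using C1(2)[OF that] C2(2)[OF that] by - (rule norm_triangle_le, linarith)
  qed
  then show ?case using C1(1) C2(1) by (intro exI[of _ "C1 + C2"]) auto
qed

text \<open>The exponent \<open>\<mu> + i / 3\<close> is tied to the power \<open>i + n\<close> of
  the weight so that the statement reproduces itself. For \<open>n = 0\<close> the factor
  \<open>k powr (i / 3)\<close> turns the weight into \<open>(1 + \<bar>\<tau>\<bar>) ^ i\<close> at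
  \<open>\<tau> = k powr (1/3) * z s\<close>, which the decay of \<open>\<Phi> i\<close>
  compensates. A derivative falling on \<open>\<Phi> i\<close> raises \<open>i\<close> by one and
  the exponent by 1/3; one falling on the coefficient leaves \<open>i\<close> unchanged and frees
  one weight factor.\<close>

lemma trans_term_weight_bound:
  assumes "smooth_on UNIV B" "compact W" "k0 > 0"
  shows "\<exists>C\<ge>0. \<forall>s\<in>W. \<forall>k\<ge>k0.
    norm (iter_dderiv half_plane (replicate n (1, 0)) (trans_term (\<mu> + real i / 3) B i) (s, k))
      * (k powr (-1/3) + \<bar>z s\<bar>) ^ (i + n) \<le> C * k powr \<mu>"
  using assms(1)
proof (induction n arbitrary: B i)
  case 0
  obtain M where M: "M \<ge> 0" "\<And>s. s \<in> W \<Longrightarrow> norm (B s) \<le> M"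
    using compact_norm_bound 0 assms(2) by blast
  obtain C where C: "\<And>\<tau>. norm (\<Phi> i \<tau>) * (1 + \<bar>\<tau>\<bar>) ^ i \<le> C" using \<Phi>_bound by blast
  have "norm (\<Phi> i 0) \<le> C" using C[of 0] by simp
  then have "C \<ge> 0" by (rule order_trans[OF norm_ge_zero])
  have "norm (trans_term (\<mu> + real i / 3) B i (s, k)) * (k powr (-1/3) + \<bar>z s\<bar>) ^ i \<le> (M * C) * k powr \<mu>"
    if s: "s \<in> W" and k: "k \<ge> k0" for s k
  proof -
    let ?\<tau> = "k powr (1/3) * z s"
    have k0: "k > 0" using k assms(3) by simp
    have "k powr (\<mu> + real i / 3) = k powr \<mu> * (k powr (1/3)) ^ i"
      using k0 by (simp add: powr_add powr_realpow[symmetric] powr_powr)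
    moreover have "(k powr (1/3)) ^ i * (k powr (-1/3) + \<bar>z s\<bar>) ^ i = (1 + \<bar>?\<tau>\<bar>) ^ i"
      using k0 by (simp add: power_mult_distrib[symmetric] distrib_left powr_add[symmetric] abs_mult)
    ultimately have "norm (trans_term (\<mu> + real i / 3) B i (s, k)) * (k powr (-1/3) + \<bar>z s\<bar>) ^ i
        = k powr \<mu> * (norm (B s) * (norm (\<Phi> i ?\<tau>) * (1 + \<bar>?\<tau>\<bar>) ^ i))"
      unfolding trans_term_def by (simp add: norm_mult mult_ac)
    also have "\<dots> \<le> k powr \<mu> * (M * C)"
      using M C s by (intro mult_left_mono mult_mono) auto
    finally show ?thesis by (simp add: mult_ac)
  qed
  then show ?case using M \<open>C \<ge> 0\<close> by (intro exI[of _ "M * C"]) auto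
next
  case (Suc n)
  obtain M where M: "M \<ge> 0" "\<And>s. s \<in> W \<Longrightarrow> norm (z s) \<le> M"
    using compact_norm_bound z_smooth assms(2) by blast
  define V where "V s k = k powr (-1/3) + \<bar>z s\<bar>" for s k
  \<comment> \<open>The upper bound absorbs the freed weight factor: \<open>k\<close> stays above
    \<open>k0\<close>, and \<open>z\<close> is bounded on the compact set \<open>W\<close>.\<close>
  have V: "0 \<le> V s k" "V s k \<le> k0 powr (-1/3) + M" if "s \<in> W" "k \<ge> k0" for s k
  proof -
    have "k powr (-1/3) \<le> k0 powr (-1/3)" using that assms(3) by (intro powr_mono2') auto
    then show "0 \<le> V s k" "V s k \<le> k0 powr (-1/3) + M"
      unfolding V_def using M(2)[OF that(1)] by auto
  qed
  let ?f1 = "iter_dderiv half_plane (replicate n (1, 0)) (trans_term (\<mu> + real i / 3) (dderiv UNIV 1 B) i)"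
  let ?f2 = "iter_dderiv half_plane (replicate n (1, 0))
    (trans_term (\<mu> + real (Suc i) / 3) (\<lambda>s. dderiv UNIV 1 z s *\<^sub>R B s) (Suc i))"
  obtain C1 where C1: "C1 \<ge> 0" "\<And>s k. s \<in> W \<Longrightarrow> k \<ge> k0 \<Longrightarrow>
      norm (?f1 (s, k)) * V s k ^ (i + n) \<le> C1 * k powr \<mu>"
    using Suc.IH[OF smooth_on_coeffs(1)[OF Suc.prems], of i] unfolding V_def by blast
  obtain C2 where C2: "C2 \<ge> 0" "\<And>s k. s \<in> W \<Longrightarrow> k \<ge> k0 \<Longrightarrow>
      norm (?f2 (s, k)) * V s k ^ (Suc i + n) \<le> C2 * k powr \<mu>"
    using Suc.IH[OF smooth_on_coeffs(2)[OF Suc.prems], of "Suc i"] unfolding V_def by blast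
  let ?K = "k0 powr (-1/3) + M"
  have "norm (iter_dderiv half_plane (replicate (Suc n) (1, 0)) (trans_term (\<mu> + real i / 3) B i) (s, k))
      * V s k ^ (i + Suc n) \<le> (C1 * ?K + C2) * k powr \<mu>" if s: "s \<in> W" and k: "k \<ge> k0" for s k
  proof -
    have x: "(s, k) \<in> half_plane" using k assms(3) by simp
    have e: "\<mu> + real i / 3 + 1/3 = \<mu> + real (Suc i) / 3" by (simp add: field_simps)
    have r: "replicate (Suc n) (1, 0) = replicate n (1, 0) @ [(1, 0) :: real \<times> real]"
      by (simp add: replicate_append_same)
    have "norm (iter_dderiv half_plane (replicate (Suc n) (1, 0)) (trans_term (\<mu> + real i / 3) B i) (s, k))
        \<le> norm (?f1 (s, k)) + norm (?f2 (s, k))"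
      unfolding r iter_dderiv_trans_term_s[OF Suc.prems x] e by (rule norm_triangle_ineq)
    then have "norm (iter_dderiv half_plane (replicate (Suc n) (1, 0)) (trans_term (\<mu> + real i / 3) B i) (s, k))
        * V s k ^ (i + Suc n) \<le> (norm (?f1 (s, k)) + norm (?f2 (s, k))) * V s k ^ (i + Suc n)"
      using V[OF s k] by (intro mult_right_mono) auto
    \<comment> \<open>The first term needs only \<open>i + n\<close> weight factors, leaving one to
      spare; the second, with index \<open>Suc i\<close>, uses all of them.\<close>
    also have "\<dots> = (norm (?f1 (s, k)) * V s k ^ (i + n)) * V s k + norm (?f2 (s, k)) * V s k ^ (Suc i + n)"
      by (simp add: algebra_simps)
    also have "\<dots> \<le> (C1 * k powr \<mu>) * ?K + C2 * k powr \<mu>"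
      using C1 V[OF s k] s k by (intro add_mono[OF mult_mono C2(2)[OF s k]]) auto
    also have "\<dots> = (C1 * ?K + C2) * k powr \<mu>" by (simp add: algebra_simps)
    finally show ?thesis .
  qed
  then show ?case unfolding V_def using C1(1) C2(1) M(1)
    by (intro exI[of _ "C1 * ?K + C2"]) auto
qed

end

section \<open>Symbol classes\<close>

lemma deriv_unique_on_times_pos: "deriv_unique_on M \<Longrightarrow> deriv_unique_on (M \<times> {0::real<..})"
  by (intro deriv_unique_on_Times) (auto intro: deriv_unique_on_open)

lemma symbol_classI:
  assumes "smooth_on (M \<times> {0<..}) (case_prod a)"
    and "\<And>W k0 vs n. compact W \<Longrightarrow> W \<subseteq> M \<Longrightarrow> 0 < k0 \<Longrightarrow> set vs \<subseteq> Basis \<Longrightarrow>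
      \<exists>C. \<forall>x\<in>W. \<forall>k\<ge>k0. norm (mixed_deriv M vs n a x k)
               \<le> C * (1 + k) powr (\<mu> - \<rho> * real n + \<delta> * real (length vs))"
  shows "symbol_class \<mu> \<rho> \<delta> M a"
  unfolding symbol_class_def using assms by blast

lemma symbol_class_smooth: "symbol_class \<mu> \<rho> \<delta> M a \<Longrightarrow> smooth_on (M \<times> {0<..}) (case_prod a)"
  by (simp add: symbol_class_def)

lemma symbol_class_bound:
  assumes "symbol_class \<mu> \<rho> \<delta> M a" "compact W" "W \<subseteq> M" "0 < k0" "set vs \<subseteq> Basis"
  obtains C where "C \<ge> 0" "\<And>x k. x \<in> W \<Longrightarrow> k \<ge> k0 \<Longrightarrow> norm (mixed_deriv M vs n a x k)
      \<le> C * (1 + k) powr (\<mu> - \<rho> * real n + \<delta> * real (length vs))"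
proof -
  let ?p = "\<lambda>k. (1 + k) powr (\<mu> - \<rho> * real n + \<delta> * real (length vs))"
  obtain C where C: "\<And>x k. x \<in> W \<Longrightarrow> k \<ge> k0 \<Longrightarrow> norm (mixed_deriv M vs n a x k) \<le> C * ?p k"
    using assms unfolding symbol_class_def by metis
  have "norm (mixed_deriv M vs n a x k) \<le> \<bar>C\<bar> * ?p k" if "x \<in> W" "k \<ge> k0" for x k
    by (rule order_trans[OF C[OF that]]) (auto intro: mult_right_mono)
  then show ?thesis by (intro that[of "\<bar>C\<bar>"]) auto
qed

lemma symbol_class_mono:
  assumes "symbol_class \<mu> \<rho> \<delta> M a" "\<mu> \<le> \<mu>'"
  shows "symbol_class \<mu>' \<rho> \<delta> M a"
proof (rule symbol_classI)
  fix W vs and k0 :: real and n :: nat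
  assume W: "compact W" "W \<subseteq> M" "0 < k0" "set vs \<subseteq> (Basis :: 'a set)"
  let ?e = "\<lambda>\<mu>. \<mu> - \<rho> * real n + \<delta> * real (length vs)"
  obtain C where C: "C \<ge> 0" "\<And>x k. x \<in> W \<Longrightarrow> k \<ge> k0 \<Longrightarrow>
      norm (mixed_deriv M vs n a x k) \<le> C * (1 + k) powr ?e \<mu>"
    using symbol_class_bound[OF assms(1) W] by metis
  have "norm (mixed_deriv M vs n a x k) \<le> C * (1 + k) powr ?e \<mu>'" if "x \<in> W" "k \<ge> k0" for x k
  proof -
    have "(1 + k) powr ?e \<mu> \<le> (1 + k) powr ?e \<mu>'"
      using that W(3) assms(2) by (intro powr_mono) auto
    then show ?thesis using C(2)[OF that] mult_left_mono[OF _ C(1)] order_trans by blast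
  qed
  then show "\<exists>C. \<forall>x\<in>W. \<forall>k\<ge>k0. norm (mixed_deriv M vs n a x k) \<le> C * (1 + k) powr ?e \<mu>'"
    by blast
qed (rule symbol_class_smooth[OF assms(1)])

lemma symbol_class_add:
  assumes "deriv_unique_on M" "symbol_class \<mu> \<rho> \<delta> M a" "symbol_class \<mu> \<rho> \<delta> M b"
  shows "symbol_class \<mu> \<rho> \<delta> M (\<lambda>x k. a x k + b x k)"
proof (rule symbol_classI)
  have split: "case_prod (\<lambda>x k. a x k + b x k) = (\<lambda>y. case_prod a y + case_prod b y)"
    by (auto simp: fun_eq_iff)
  note sm = symbol_class_smooth[OF assms(2)] symbol_class_smooth[OF assms(3)]
  note du = deriv_unique_on_times_pos[OF assms(1)]
  show "smooth_on (M \<times> {0<..}) (case_prod (\<lambda>x k. a x k + b x k))"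
    unfolding split by (intro smooth_on_add du sm)
  fix W vs and k0 :: real and n :: nat
  assume W: "compact W" "W \<subseteq> M" "0 < k0" "set vs \<subseteq> (Basis :: 'a set)"
  let ?p = "\<lambda>k. (1 + k) powr (\<mu> - \<rho> * real n + \<delta> * real (length vs))"
  obtain C where C: "\<And>x k. x \<in> W \<Longrightarrow> k \<ge> k0 \<Longrightarrow> norm (mixed_deriv M vs n a x k) \<le> C * ?p k"
    using symbol_class_bound[OF assms(2) W] by metis
  obtain D where D: "\<And>x k. x \<in> W \<Longrightarrow> k \<ge> k0 \<Longrightarrow> norm (mixed_deriv M vs n b x k) \<le> D * ?p k"
    using symbol_class_bound[OF assms(3) W] by metis
  have "norm (mixed_deriv M vs n (\<lambda>x k. a x k + b x k) x k) \<le> (C + D) * ?p k"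
    if "x \<in> W" "k \<ge> k0" for x k
  proof -
    have "(x, k) \<in> M \<times> {0<..}" using that W by auto
    then have "mixed_deriv M vs n (\<lambda>x k. a x k + b x k) x k
        = mixed_deriv M vs n a x k + mixed_deriv M vs n b x k"
      unfolding mixed_deriv_eq_iter_dderiv split by (intro iter_dderiv_add du sm)
    then show ?thesis
      using C[OF that] D[OF that] unfolding distrib_right
      by (simp only:) (rule norm_triangle_le, linarith)
  qed
  then show "\<exists>C. \<forall>x\<in>W. \<forall>k\<ge>k0. norm (mixed_deriv M vs n (\<lambda>x k. a x k + b x k) x k) \<le> C * ?p k"
    by blast
qed

lemma mixed_deriv_subset:
  assumes "deriv_unique_on M" "M \<subseteq> M'" "smooth_on (M' \<times> {0<..}) (case_prod a)" "x \<in> M" "k > 0"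
  shows "mixed_deriv M vs n a x k = mixed_deriv M' vs n a x k"
  unfolding mixed_deriv_eq_iter_dderiv
  using assms by (intro iter_dderiv_subset deriv_unique_on_times_pos) auto

lemma symbol_class_subset:
  assumes "deriv_unique_on M" "M \<subseteq> M'" "symbol_class \<mu> \<rho> \<delta> M' a"
  shows "symbol_class \<mu> \<rho> \<delta> M a"
proof (rule symbol_classI)
  note sm = symbol_class_smooth[OF assms(3)]
  show "smooth_on (M \<times> {0<..}) (case_prod a)"
    using assms by (intro smooth_on_subset[OF _ _ sm] deriv_unique_on_times_pos) auto
  fix W vs and k0 :: real and n :: nat
  assume W: "compact W" "W \<subseteq> M" "0 < k0" "set vs \<subseteq> (Basis :: 'a set)"
  then have "W \<subseteq> M'" using assms(2) by blast
  let ?p = "\<lambda>k. (1 + k) powr (\<mu> - \<rho> * real n + \<delta> * real (length vs))"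
  obtain C where C: "\<And>x k. x \<in> W \<Longrightarrow> k \<ge> k0 \<Longrightarrow> norm (mixed_deriv M' vs n a x k) \<le> C * ?p k"
    using symbol_class_bound[OF assms(3) W(1) \<open>W \<subseteq> M'\<close> W(3,4)] by metis
  moreover have "mixed_deriv M vs n a x k = mixed_deriv M' vs n a x k" if "x \<in> W" "k \<ge> k0" for x k
    using W that by (intro mixed_deriv_subset assms sm) auto
  ultimately show "\<exists>C. \<forall>x\<in>W. \<forall>k\<ge>k0. norm (mixed_deriv M vs n a x k) \<le> C * ?p k"
    by metis
qed

text \<open>A periodic parameterization is injective only on pieces no longer than a period, so
  symbol estimates are available piecewise. Smoothness is glued over an open cover, and the
  constants on a compact set are joined by bisection.\<close>

lemma symbol_class_UNIV_if_local:
  fixes P :: real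
  assumes P: "0 < P" and loc: "\<And>a. symbol_class \<mu> \<rho> \<delta> {a<..<a + P} f"
  shows "symbol_class \<mu> \<rho> \<delta> UNIV f"
proof (rule symbol_classI)
  have cover: "(\<Union>a. {a<..<a + P}) = UNIV"
  proof -
    have "x \<in> {x - P/2<..<x - P/2 + P}" for x using P by auto
    then show ?thesis by blast
  qed
  have "smooth_on (\<Union>a. {a<..<a + P} \<times> {0<..}) (case_prod f)"
    using loc by (intro smooth_on_UN symbol_class_smooth) (auto intro: open_Times)
  moreover have "(\<Union>a. {a<..<a + P} \<times> {0<..}) = UNIV \<times> ({0<..} :: real set)"
    using cover by blast
  ultimately show sm: "smooth_on (UNIV \<times> {0<..}) (case_prod f)" by simp
  fix W :: "real set" and k0 :: real and vs :: "real list" and n :: nat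
  assume W: "compact W" and k0: "0 < k0" and vs: "set vs \<subseteq> Basis"
  let ?p = "\<lambda>k. (1 + k) powr (\<mu> - \<rho> * real n + \<delta> * real (length vs))"
  define Q where "Q c d \<longleftrightarrow>
    (\<exists>C. \<forall>x\<in>{c..d}. \<forall>k\<ge>k0. norm (mixed_deriv UNIV vs n f x k) \<le> C * ?p k)" for c d
  obtain M where M: "M \<ge> 0" "W \<subseteq> {-M..M}"
  proof -
    obtain M where "M > 0" "\<forall>x\<in>W. norm x \<le> M" using compact_imp_bounded[OF W] unfolding bounded_pos by blast
    then show ?thesis by (intro that[of M]) (force simp: abs_le_iff)+
  qed
  have "- M \<le> M" using M by simp
  then have "Q (- M) M"
  proof (induction rule: Bolzano)
    case (trans c d e)
    then obtain C D where C: "\<And>x k. x \<in> {c..d} \<Longrightarrow> k \<ge> k0 \<Longrightarrow> norm (mixed_deriv UNIV vs n f x k) \<le> C * ?p k"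
      and D: "\<And>x k. x \<in> {d..e} \<Longrightarrow> k \<ge> k0 \<Longrightarrow> norm (mixed_deriv UNIV vs n f x k) \<le> D * ?p k"
      unfolding Q_def by metis
    have "norm (mixed_deriv UNIV vs n f x k) \<le> max C D * ?p k" if "x \<in> {c..e}" "k \<ge> k0" for x k
    proof -
      have "norm (mixed_deriv UNIV vs n f x k) \<le> C * ?p k \<or> norm (mixed_deriv UNIV vs n f x k) \<le> D * ?p k"
        using C[of x k] D[of x k] that by (cases "x \<le> d") auto
      moreover have "C * ?p k \<le> max C D * ?p k" "D * ?p k \<le> max C D * ?p k"
        by (auto intro: mult_right_mono)
      ultimately show ?thesis by linarith
    qed
    then show ?case unfolding Q_def by blast
  next
    case (local x)
    let ?J = "{x - P/2<..<x - P/2 + P}"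
    \<comment> \<open>A compact interval inside the chart centred at \<open>x\<close> is required by
      the local estimate. Any interval containing \<open>x\<close> and shorter than
      \<open>P/4\<close> lies in it.\<close>
    have J: "{x - P/4..x + P/4} \<subseteq> ?J" using P by auto
    obtain C where C: "\<And>y k. y \<in> {x - P/4..x + P/4} \<Longrightarrow> k \<ge> k0 \<Longrightarrow> norm (mixed_deriv ?J vs n f y k) \<le> C * ?p k"
      using symbol_class_bound[OF loc compact_Icc J k0 vs] by metis
    have "norm (mixed_deriv UNIV vs n f y k) \<le> C * ?p k"
      if "y \<in> {x - P/4..x + P/4}" "k \<ge> k0" for y k
    proof -
      have "mixed_deriv ?J vs n f y k = mixed_deriv UNIV vs n f y k"
        using that J k0 by (intro mixed_deriv_subset sm deriv_unique_on_open) auto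
      then show ?thesis using C[OF that] by simp
    qed
    then have "Q c d" if "c \<le> x" "x \<le> d" "d - c < P/4" for c d
      using that unfolding Q_def by (intro exI[of _ C]) auto
    then show ?case using P by (intro exI[of _ "P/4"]) auto
  qed
  then show "\<exists>C. \<forall>x\<in>W. \<forall>k\<ge>k0. norm (mixed_deriv UNIV vs n f x k) \<le> C * ?p k"
    using M(2) unfolding Q_def by blast
qed

lemma (in transition_terms) symbol_class_trans_term:
  assumes "smooth_on UNIV B"
  shows "symbol_class \<nu> (2/3) (1/3) UNIV (\<lambda>s k. trans_term \<nu> B i (s, k))"
proof (rule symbol_classI)
  show "smooth_on half_plane (case_prod (\<lambda>s k. trans_term \<nu> B i (s, k)))"
    using smooth_on_trans_term[OF assms] by simp
  fix W :: "real set" and k0 :: real and vs :: "real list" and n :: nat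
  assume W: "compact W" and k0: "0 < k0" and vs: "set vs \<subseteq> Basis"
  let ?ws = "map (\<lambda>v. (v, 0)) vs @ replicate n (0, 1) :: (real \<times> real) list"
  have "set ?ws \<subseteq> {(1, 0), (0, 1)}" using vs by (auto simp: set_replicate_conv_if)
  from trans_term_symbol_bound[OF assms this W k0, of \<nu> i]
  obtain C where C: "\<And>s k. s \<in> W \<Longrightarrow> k \<ge> k0 \<Longrightarrow>
      norm (iter_dderiv half_plane ?ws (trans_term \<nu> B i) (s, k))
      \<le> C * (1 + k) powr (\<nu> + (\<Sum>w\<leftarrow>?ws. fst w / 3 - 2 / 3 * snd w))" by blast
  \<comment> \<open>The only basis vector of the real line is 1, so each entry of \<open>vs\<close>
    contributes exactly 1/3.\<close>
  have "(\<Sum>w\<leftarrow>map (\<lambda>v. (v, 0)) vs. fst w / 3 - 2 / 3 * snd w) = real (length vs) / 3"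
    using vs by (induction vs) (auto simp: add_divide_distrib)
  then have e: "\<nu> + (\<Sum>w\<leftarrow>?ws. fst w / 3 - 2 / 3 * snd w) = \<nu> - 2 / 3 * real n + 1 / 3 * real (length vs)"
    by (simp add: sum_list_replicate)
  show "\<exists>C. \<forall>s\<in>W. \<forall>k\<ge>k0. norm (mixed_deriv UNIV vs n (\<lambda>s k. trans_term \<nu> B i (s, k)) s k)
      \<le> C * (1 + k) powr (\<nu> - 2 / 3 * real n + 1 / 3 * real (length vs))"
    using C unfolding e mixed_deriv_eq_iter_dderiv by auto
qed

section \<open>Charts of a periodic parameterization\<close>

lemma ccw_param_reduce:
  assumes "ccw_param K \<gamma> P"
  obtains j :: int where "s + of_int j * P \<in> {0..<P}" "\<gamma> (s + of_int j * P) = \<gamma> s"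
proof -
  interpret periodic_fun_simple \<gamma> P
    using assms by unfold_locales (simp add: ccw_param_def)
  have "P > 0" using assms by (simp add: ccw_param_def)
  then have "s + of_int (- \<lfloor>s / P\<rfloor>) * P \<in> {0..<P}"
    using floor_divide_lower[of P s] floor_divide_upper[of P s] by (auto simp: algebra_simps)
  then show ?thesis using plus_of_int that by blast
qed

text \<open>Shifting two parameters with the same image into the fundamental period shows that they
  differ by an integer multiple of \<open>P\<close>. Inside an open interval of length
  \<open>P\<close> this multiple is zero.\<close>

lemma ccw_param_local_param:
  assumes "ccw_param K \<gamma> P"
  shows "local_param (frontier K) {a<..<a + P} \<gamma>"
proof -
  from assms have P: "P > 0" and sm: "smooth_on UNIV \<gamma>" and inj: "inj_on \<gamma> {0..<P}"
    and im: "\<gamma> ` {0..<P} = frontier K" and reg: "\<And>s. vector_derivative \<gamma> (at s) \<noteq> 0"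
    by (auto simp: ccw_param_def)
  have "inj_on \<gamma> {a<..<a + P}"
  proof
    fix x y assume x: "x \<in> {a<..<a + P}" and y: "y \<in> {a<..<a + P}" and eq: "\<gamma> x = \<gamma> y"
    obtain i where i: "x + of_int i * P \<in> {0..<P}" "\<gamma> (x + of_int i * P) = \<gamma> x"
      by (rule ccw_param_reduce[OF assms])
    obtain j where j: "y + of_int j * P \<in> {0..<P}" "\<gamma> (y + of_int j * P) = \<gamma> y"
      by (rule ccw_param_reduce[OF assms])
    have "x + of_int i * P = y + of_int j * P"
      using i j eq inj by (metis inj_onD)
    then have "x - y = of_int (j - i) * P" by (simp add: algebra_simps)
    moreover have "\<bar>x - y\<bar> < P" using x y by auto
    ultimately have "\<bar>of_int (j - i) :: real\<bar> * P < 1 * P" using P by (simp add: abs_mult)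
    then have "\<bar>of_int (j - i) :: real\<bar> < 1" using P mult_less_cancel_right_pos by blast
    then have "j - i = 0" by linarith
    with \<open>x - y = _\<close> show "x = y" by simp
  qed
  moreover have "\<gamma> s \<in> frontier K" for s
    by (rule ccw_param_reduce[OF assms, of s]) (metis im imageI)
  moreover have "smooth_on {a<..<a + P} \<gamma>"
    by (intro smooth_on_subset[OF _ _ sm] deriv_unique_on_open) auto
  ultimately show ?thesis using reg by (auto simp: local_param_def is_interval_oo)
qed

lemma smooth_on_curve_smooth:
  assumes \<gamma>: "ccw_param K \<gamma> P" and f: "curve_smooth (frontier K) f"
  shows "smooth_on UNIV (f \<circ> \<gamma>)"
proof -
  have P: "P > 0" using \<gamma> by (simp add: ccw_param_def)
  have "smooth_on (\<Union>a. {a<..<a + P}) (f \<circ> \<gamma>)"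
    using f ccw_param_local_param[OF \<gamma>] by (intro smooth_on_UN) (auto simp: curve_smooth_def)
  moreover have "x \<in> (\<Union>a. {a<..<a + P})" for x
    using P by (intro UN_I[of "x - P/2"]) auto
  then have "(\<Union>a. {a<..<a + P}) = UNIV" by blast
  ultimately show ?thesis by simp
qed

lemma symbol_class_curve_symbol:
  assumes "ccw_param K \<gamma> P" "curve_symbol \<mu> \<rho> \<delta> (frontier K) f"
  shows "symbol_class \<mu> \<rho> \<delta> UNIV (\<lambda>s k. f (\<gamma> s) k)"
proof (rule symbol_class_UNIV_if_local[where P = P])
  show "0 < P" using assms by (simp add: ccw_param_def)
  show "symbol_class \<mu> \<rho> \<delta> {a<..<a + P} (\<lambda>s k. f (\<gamma> s) k)" for a
    using assms ccw_param_local_param unfolding curve_symbol_def by blast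
qed

section \<open>The terms of the expansion\<close>

text \<open>For \<open>l \<le> -1\<close> the quantity \<open>1 + l - 2 * r - p\<close> is never
  positive, and in the limiting case 0 the additional summand of \<open>theta\<close> is 0 as
  well.\<close>

lemma theta_eq_term_order: "\<iota> \<in> indices \<Longrightarrow> theta \<iota> = term_order \<iota>"
  by (cases \<iota>) (auto simp: indices_def)

lemma expansion_term_bounds:
  assumes \<Psi>: "transition_family \<Psi>" and \<iota>: "\<iota> \<in> indices"
    and B: "smooth_on UNIV (b \<iota> \<circ> \<gamma>)" and z: "smooth_on UNIV (Z \<circ> \<gamma>)"
  shows "symbol_class (term_order \<iota>) (2/3) (1/3) UNIV (\<lambda>s k. expansion_term \<Psi> b Z \<iota> (\<gamma> s) k)" (is ?th1)
    and "compact W \<Longrightarrow> k0 > 0 \<Longrightarrow> \<exists>C\<ge>0. \<forall>s\<in>W. \<forall>k\<ge>k0.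
      norm (iter_dderiv half_plane (replicate n (1, 0)) (\<lambda>(s, k). expansion_term \<Psi> b Z \<iota> (\<gamma> s) k) (s, k))
        * (k powr (-1/3) + \<bar>Z (\<gamma> s)\<bar>) ^ n \<le> C * k powr term_order \<iota>" (is "_ \<Longrightarrow> _ \<Longrightarrow> ?th2")
proof -
  obtain p q r l where eq: "\<iota> = (p, q, r, l)" by (cases \<iota>)
  have l: "l \<le> -1" using \<iota> by (auto simp: eq indices_def)
  have sm: "smooth_on UNIV (\<Psi> r l)" using \<Psi> l by (simp add: transition_family_def)
  interpret transition_terms "\<lambda>i. nth_deriv (p + i) (\<Psi> r l)" "Z \<circ> \<gamma>"
  proof
    fix i
    show "(nth_deriv (p + i) (\<Psi> r l) has_vector_derivative nth_deriv (p + Suc i) (\<Psi> r l) \<tau>) (at \<tau>)" for \<tau>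
      using nth_deriv_has_vector_derivative[OF sm] by simp
    \<comment> \<open>The derivative of order \<open>p + i\<close> decays with exponent
      \<open>p + i\<close>; this is weakened to \<open>i\<close>, so that the chain starts with a
      merely bounded function.\<close>
    obtain C where C: "\<And>\<tau>. norm (nth_deriv (p + i) (\<Psi> r l) \<tau>) * (1 + \<bar>\<tau>\<bar>) ^ (p + i) \<le> C"
      using transition_family_bound[OF \<Psi> l] by blast
    have "norm (nth_deriv (p + i) (\<Psi> r l) \<tau>) * (1 + \<bar>\<tau>\<bar>) ^ i \<le> C" for \<tau>
      by (rule order_trans[OF _ C[of \<tau>]]) (auto intro!: mult_left_mono power_increasing)
    then show "\<exists>C. \<forall>\<tau>. norm (nth_deriv (p + i) (\<Psi> r l) \<tau>) * (1 + \<bar>\<tau>\<bar>) ^ i \<le> C" by blast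
  qed (rule z)
  have t: "expansion_term \<Psi> b Z \<iota> (\<gamma> s) k = trans_term (term_order \<iota>) (b \<iota> \<circ> \<gamma>) 0 (s, k)" for s k
    by (simp add: eq trans_term_def scaleR_conv_of_real)
  show ?th1 unfolding t by (rule symbol_class_trans_term[OF B])
  show ?th2 if "compact W" "k0 > 0"
    using trans_term_weight_bound[OF B that, of n "term_order \<iota>" 0]
    unfolding t by (simp add: case_prod_eta)
qed

text \<open>Each term is first lifted from its own order to the common order \<open>\<mu>\<close>;
  the remainder \<open>R\<close> forms the base case of the induction over \<open>I\<close>.\<close>

lemma symbol_class_add_expansion_terms:
  fixes \<gamma> :: "real \<Rightarrow> real^2"
  assumes "transition_family \<Psi>" "I \<subseteq> indices" "finite I"
    and "\<And>\<iota>. \<iota> \<in> I \<Longrightarrow> smooth_on UNIV (b \<iota> \<circ> \<gamma>)" "smooth_on UNIV (Z \<circ> \<gamma>)"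
    and "\<And>\<iota>. \<iota> \<in> I \<Longrightarrow> term_order \<iota> \<le> \<mu>"
    and "symbol_class \<mu> (2/3) (1/3) UNIV R"
  shows "symbol_class \<mu> (2/3) (1/3) UNIV (\<lambda>s k. R s k + (\<Sum>\<iota>\<in>I. expansion_term \<Psi> b Z \<iota> (\<gamma> s) k))"
  using assms(3,2,4,6)
proof (induction I rule: finite_induct)
  case empty
  then show ?case using assms(7) by simp
next
  case (insert \<iota> I)
  have "symbol_class \<mu> (2/3) (1/3) UNIV (\<lambda>s k. expansion_term \<Psi> b Z \<iota> (\<gamma> s) k)"
    using insert.prems expansion_term_bounds(1)[where b = b and \<iota> = \<iota>, OF assms(1) _ _ assms(5)]
    by (blast intro: symbol_class_mono)
  moreover have "symbol_class \<mu> (2/3) (1/3) UNIV (\<lambda>s k. R s k + (\<Sum>\<iota>\<in>I. expansion_term \<Psi> b Z \<iota> (\<gamma> s) k))"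
    using insert by auto
  ultimately have "symbol_class \<mu> (2/3) (1/3) UNIV (\<lambda>s k. expansion_term \<Psi> b Z \<iota> (\<gamma> s) k
      + (R s k + (\<Sum>\<iota>\<in>I. expansion_term \<Psi> b Z \<iota> (\<gamma> s) k)))"
    by (rule symbol_class_add[OF deriv_unique_on_open[OF open_UNIV]])
  then show ?case using insert by (simp add: algebra_simps)
qed

text \<open>Over one period the zeros of \<open>Z\<close> along the curve are simple and occur only
  at shadow boundary parameters, where \<open>omega\<close> vanishes too. The quotient of the two is
  then bounded, which is the direction that dominates \<open>W_weight\<close> by the natural weight
  of the terms.\<close>

lemma omega_le_const_mult_shadow_boundary_function:
  assumes \<gamma>: "ccw_param K \<gamma> P" and Z: "shadow_boundary_function K d Z"
    and t: "t1 \<in> {0<..<P}" "t2 \<in> {0<..<P}" and SB: "SB K d = {\<gamma> t1, \<gamma> t2}"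
  shows "\<exists>C. \<forall>s\<in>{0..P}. \<bar>omega t1 t2 s\<bar> \<le> C * \<bar>Z (\<gamma> s)\<bar>"
proof -
  have P: "P > 0" and inj: "inj_on \<gamma> {0..<P}" and "\<forall>s. \<gamma> (s + P) = \<gamma> s"
    using \<gamma> by (auto simp: ccw_param_def)
  from this(3)[rule_format, of 0] have per: "\<gamma> P = \<gamma> 0" by simp
  have "smooth_on UNIV (Z \<circ> \<gamma>)"
    using Z unfolding shadow_boundary_function_def by (intro smooth_on_curve_smooth[OF \<gamma>]) blast
  note z = smooth_on_has_vector_derivative[OF this]
  have w: "(omega t1 t2 has_real_derivative (t2 - s) - (s - t1)) (at s)" for s
    unfolding omega_def by (auto intro!: derivative_eq_intros)
  have zd: "((\<lambda>s. Z (\<gamma> s)) has_real_derivative dderiv UNIV 1 (Z \<circ> \<gamma>) s) (at s)" for s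
    using z[of s] by (simp add: has_real_derivative_iff_has_vector_derivative o_def)
  show ?thesis
  proof (rule abs_le_const_mult_if_simple_zeros[OF _ w zd])
    fix s assume s: "s \<in> {0..P}" and z0: "Z (\<gamma> s) = 0"
    let ?J = "{s - P/2<..<s - P/2 + P}"
    have lp: "local_param (frontier K) ?J \<gamma>" by (rule ccw_param_local_param[OF \<gamma>])
    have sJ: "s \<in> ?J" using P by auto
    with lp have "\<gamma> s \<in> frontier K" by (auto simp: local_param_def)
    \<comment> \<open>The sign of \<open>Z\<close> separates the illuminated and shadow regions
      strictly, so a zero can lie only on the shadow boundary.\<close>
    then have sb: "\<gamma> s \<in> SB K d"
      using Z z0 unfolding shadow_boundary_function_def IL_def SB_def SR_def
      by (cases "d (\<gamma> s) \<bullet> outer_normal K (\<gamma> s)" "0::real" rule: linorder_cases) force+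
    have "s = t1 \<or> s = t2"
    \<comment> \<open>The endpoint \<open>P\<close> is outside the injectivity interval and is
      identified with 0. Since \<open>t1\<close> and \<open>t2\<close> are strictly positive, it
      cannot lie on the shadow boundary.\<close>
    proof (cases "s = P")
      case True
      then have "\<gamma> 0 = \<gamma> t1 \<or> \<gamma> 0 = \<gamma> t2" using sb SB per by auto
      then show ?thesis using t P inj_onD[OF inj, of 0] by force
    next
      case False
      then have "s \<in> {0..<P}" using s by auto
      then show ?thesis using sb SB t inj_onD[OF inj, of s] by auto
    qed
    moreover have "vector_derivative (Z \<circ> \<gamma>) (at s) \<noteq> 0"
      using Z lp sJ sb unfolding shadow_boundary_function_def by blast
    ultimately show "dderiv UNIV 1 (Z \<circ> \<gamma>) s \<noteq> 0 \<and> omega t1 t2 s = 0"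
      using vector_derivative_at[OF z] by (auto simp: omega_def)
  qed (use P in simp)
qed

section \<open>Weighted bounds for the remainder and for single terms\<close>

lemma W_weight_pos: "k > 0 \<Longrightarrow> 0 < W_weight t1 t2 s k"
  by (simp add: W_weight_def add_pos_nonneg)

text \<open>With order \<open>-\<beta> - n\<close>, the \<open>n\<close>-th derivative in
  \<open>s\<close> is still of order \<open>-\<beta> - 2 * n / 3\<close>, hence at most
  \<open>-\<beta> / 3\<close>. The weight costs only a constant, being bounded by
  \<open>1 + P * P\<close>.\<close>

lemma remainder_weight_bound:
  assumes "symbol_class (- real \<beta> - real n) (2/3) (1/3) UNIV R"
    and t: "t1 \<in> {0<..<P}" "t2 \<in> {0<..<P}" and k0: "k0 > 1"
  shows "\<exists>C\<ge>0. \<forall>s\<in>{0..P}. \<forall>k\<ge>k0.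
    norm (iter_dderiv half_plane (replicate n (1, 0)) (case_prod R) (s, k)) * W_weight t1 t2 s k ^ n
      \<le> C * k powr (- real \<beta> / 3)"
proof -
  have eq: "mixed_deriv UNIV (replicate n 1) 0 R s k
      = iter_dderiv half_plane (replicate n (1, 0)) (case_prod R) (s, k)" for s k
    by (simp add: mixed_deriv_eq_iter_dderiv)
  have "0 < k0" "set (replicate n (1::real)) \<subseteq> Basis" using k0 by (auto simp: set_replicate_conv_if)
  from symbol_class_bound[OF assms(1) compact_Icc subset_UNIV this, of 0 P 0]
  obtain C where C: "C \<ge> 0" "\<And>s k. s \<in> {0..P} \<Longrightarrow> k \<ge> k0 \<Longrightarrow>
      norm (iter_dderiv half_plane (replicate n (1, 0)) (case_prod R) (s, k))
        \<le> C * (1 + k) powr (- real \<beta> - real n - 2/3 * real 0 + 1/3 * real (length (replicate n (1::real))))"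
    unfolding eq by blast
  have "norm (iter_dderiv half_plane (replicate n (1, 0)) (case_prod R) (s, k)) * W_weight t1 t2 s k ^ n
      \<le> (C * k powr (- real \<beta> / 3)) * (1 + P * P) ^ n"
    if s: "s \<in> {0..P}" and k: "k \<ge> k0" for s k
  proof (intro mult_mono)
    have "(1 + k) powr (- real \<beta> - real n - 2/3 * real 0 + 1/3 * real (length (replicate n (1::real))))
        \<le> (1 + k) powr (- real \<beta> / 3)"
      using k k0 by (intro powr_mono) auto
    also have "\<dots> \<le> k powr (- real \<beta> / 3)" using k k0 by (intro powr_mono2') auto
    finally show "norm (iter_dderiv half_plane (replicate n (1, 0)) (case_prod R) (s, k))
        \<le> C * k powr (- real \<beta> / 3)"
      using C(2)[OF s k] mult_left_mono[OF _ C(1)] order_trans by blast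
    have "\<bar>s - t1\<bar> * \<bar>t2 - s\<bar> \<le> P * P" using s t by (intro mult_mono) auto
    \<comment> \<open>Here \<open>k0 > 1\<close> enters: it bounds the first summand of the weight
      by 1.\<close>
    moreover have "k powr (-1/3) \<le> k powr 0" using k k0 by (intro powr_mono) auto
    ultimately have "W_weight t1 t2 s k \<le> 1 + P * P"
      using k k0 unfolding W_weight_def omega_def abs_mult by auto
    then show "W_weight t1 t2 s k ^ n \<le> (1 + P * P) ^ n"
      using W_weight_pos[of k t1 t2 s] k k0 by (intro power_mono) auto
  qed (use C(1) k k0 W_weight_pos[of k t1 t2 s] in auto)
  then show ?thesis
    using C(1) t by (intro exI[of _ "C * (1 + P * P) ^ n"]) (auto simp: mult_ac)
qed

lemma term_weight_bound:
  assumes "transition_family \<Psi>" "\<iota> \<in> indices" "term_order \<iota> \<le> \<mu>"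
    and "smooth_on UNIV (b \<iota> \<circ> \<gamma>)" "smooth_on UNIV (Z \<circ> \<gamma>)"
    and om: "\<And>s. s \<in> {0..P} \<Longrightarrow> \<bar>omega t1 t2 s\<bar> \<le> D * \<bar>Z (\<gamma> s)\<bar>" and k0: "k0 > 1"
  shows "\<exists>C\<ge>0. \<forall>s\<in>{0..P}. \<forall>k\<ge>k0.
    norm (iter_dderiv half_plane (replicate n (1, 0)) (\<lambda>(s, k). expansion_term \<Psi> b Z \<iota> (\<gamma> s) k) (s, k))
      * W_weight t1 t2 s k ^ n \<le> C * k powr \<mu>"
proof -
  let ?f = "iter_dderiv half_plane (replicate n (1, 0)) (\<lambda>(s, k). expansion_term \<Psi> b Z \<iota> (\<gamma> s) k)"
  have "k0 > 0" using k0 by simp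
  from expansion_term_bounds(2)[where b = b, OF assms(1,2,4,5) compact_Icc this, of 0 P n]
  obtain C where C: "C \<ge> 0" "\<And>s k. s \<in> {0..P} \<Longrightarrow> k \<ge> k0 \<Longrightarrow>
      norm (?f (s, k)) * (k powr (-1/3) + \<bar>Z (\<gamma> s)\<bar>) ^ n \<le> C * k powr term_order \<iota>"
    by blast
  \<comment> \<open>The constant must dominate 1 for the summand \<open>k powr (-1/3)\<close> of the
    weight and \<open>D\<close> for the summand with \<open>omega\<close>.\<close>
  let ?D = "max 1 D"
  have "norm (?f (s, k)) * W_weight t1 t2 s k ^ n \<le> (?D ^ n * C) * k powr \<mu>"
    if s: "s \<in> {0..P}" and k: "k \<ge> k0" for s k
  proof -
    let ?V = "k powr (-1/3) + \<bar>Z (\<gamma> s)\<bar>"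
    have "D * \<bar>Z (\<gamma> s)\<bar> \<le> ?D * \<bar>Z (\<gamma> s)\<bar>" "1 * k powr (-1/3) \<le> ?D * k powr (-1/3)"
      by (intro mult_right_mono; simp)+
    then have "W_weight t1 t2 s k \<le> ?D * ?V"
      using om[OF s] unfolding W_weight_def distrib_left by linarith
    then have "W_weight t1 t2 s k ^ n \<le> (?D * ?V) ^ n"
      using W_weight_pos[of k t1 t2 s] k k0 by (intro power_mono) auto
    then have "norm (?f (s, k)) * W_weight t1 t2 s k ^ n \<le> norm (?f (s, k)) * (?D * ?V) ^ n"
      by (intro mult_left_mono) auto
    also have "\<dots> = ?D ^ n * (norm (?f (s, k)) * ?V ^ n)" by (simp only: power_mult_distrib mult_ac)
    also have "\<dots> \<le> ?D ^ n * (C * k powr term_order \<iota>)"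
      using C(2)[OF s k] by (intro mult_left_mono) auto
    also have "\<dots> \<le> ?D ^ n * (C * k powr \<mu>)"
      using C(1) assms(3) k k0 by (intro mult_left_mono powr_mono) auto
    finally show ?thesis by (simp add: mult_ac)
  qed
  then show ?thesis using C(1) by (intro exI[of _ "?D ^ n * C"]) auto
qed

section \<open>Splitting the remainder and deriving both estimates\<close>

theorem theorem6:
  fixes \<K> :: "(real^2) set set"
    and K :: "nat \<Rightarrow> (real^2) set"
    and \<alpha> :: "real^2"
    and \<Psi> :: "nat \<Rightarrow> int \<Rightarrow> real \<Rightarrow> complex"
    and u :: "nat \<Rightarrow> real^2 \<Rightarrow> real \<Rightarrow> complex"
    and b :: "nat \<Rightarrow> index \<Rightarrow> real^2 \<Rightarrow> complex"
    and Z :: "nat \<Rightarrow> real^2 \<Rightarrow> real"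
    and \<gamma> :: "nat \<Rightarrow> real \<Rightarrow> real^2"
    and P t1 t2 :: "nat \<Rightarrow> real"
    and m \<beta> :: nat
  assumes "finite \<K>" and "disjoint \<K>"
    and "\<And>C. C \<in> \<K> \<Longrightarrow> smooth_strictly_convex_obstacle C"
    and "range K \<subseteq> \<K>"
    and "norm \<alpha> = 1"
    and "assumption_A K \<alpha>"
    and "assumption_B \<Psi>"
    and "multiple_scattering K \<alpha> u"
    and "\<And>m. envelope_expansion \<Psi> (K m) (inc_dir K \<alpha> m) (eta_slow K \<alpha> u m) (b m) (Z m)"
    and "\<And>m. ccw_param (K m) (\<gamma> m) (P m)"
    and "\<And>m. t1 m \<in> {0<..<P m}" and "\<And>m. t2 m \<in> {0<..<P m}"
    and "\<And>m. SB (K m) (inc_dir K \<alpha> m) = {\<gamma> m (t1 m), \<gamma> m (t2 m)}"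
  shows "symbol_class (- real \<beta> / 3) (2/3) (1/3) {0..P m} (rho_slow K \<alpha> u \<Psi> b Z \<gamma> m \<beta>)
    \<and> (\<forall>k0>1. \<forall>n::nat. \<exists>C. \<forall>s\<in>{0..P m}. \<forall>k\<ge>k0.
         norm (mixed_deriv {0..P m} (replicate n 1) 0 (rho_slow K \<alpha> u \<Psi> b Z \<gamma> m \<beta>) s k)
           \<le> C * k powr (- real \<beta> / 3) * W_weight (t1 m) (t2 m) s k powi (- int n))"
proof -
  let ?\<gamma> = "\<gamma> m" and ?P = "P m" and ?b = "b m" and ?Z = "Z m"
  let ?f = "eta_slow K \<alpha> u m" and ?\<mu> = "- real \<beta> / 3" and ?\<rho> = "rho_slow K \<alpha> u \<Psi> b Z \<gamma> m \<beta>"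
  let ?t = "\<lambda>\<iota> s k. expansion_term \<Psi> ?b ?Z \<iota> (?\<gamma> s) k"
  have \<Psi>: "transition_family \<Psi>" using assms(7) by (simp add: assumption_B_def)
  note \<gamma> = assms(10)[of m]
  have P: "?P > 0" using \<gamma> by (simp add: ccw_param_def)
  have sbf: "shadow_boundary_function (K m) (inc_dir K \<alpha> m) ?Z"
    and bs: "\<And>\<iota>. \<iota> \<in> indices \<Longrightarrow> curve_smooth (frontier (K m)) (?b \<iota>)"
    and exp: "asymp_sum (\<lambda>\<mu>. curve_symbol \<mu> (2/3) (1/3) (frontier (K m))) indices
      (expansion_term \<Psi> ?b ?Z) ?f"
    using assms(9)[of m] unfolding envelope_expansion_def by blast+
  have b\<gamma>: "smooth_on UNIV (?b \<iota> \<circ> ?\<gamma>)" if "\<iota> \<in> indices" for \<iota>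
    by (rule smooth_on_curve_smooth[OF \<gamma> bs[OF that]])
  have Z\<gamma>: "smooth_on UNIV (?Z \<circ> ?\<gamma>)"
    using sbf unfolding shadow_boundary_function_def by (intro smooth_on_curve_smooth[OF \<gamma>]) blast
  \<comment> \<open>For every \<open>N\<close> the remainder is a symbol of order \<open>-N\<close>
    plus finitely many terms of order at most \<open>-\<beta> / 3\<close>. The split depends on
    \<open>N\<close>, hence is chosen afresh for each estimate.\<close>
  have decomp: "\<exists>R I. symbol_class (- real N) (2/3) (1/3) UNIV R \<and> finite I \<and> I \<subseteq> indices \<and>
      (\<forall>\<iota>\<in>I. term_order \<iota> \<le> ?\<mu>) \<and> ?\<rho> = (\<lambda>s k. R s k + (\<Sum>\<iota>\<in>I. ?t \<iota> s k))" for N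
  proof -
    obtain F where F: "finite F \<and> F \<subseteq> indices \<and> (\<forall>F'. finite F' \<and> F \<subseteq> F' \<and> F' \<subseteq> indices \<longrightarrow>
        curve_symbol (- real N) (2/3) (1/3) (frontier (K m))
          (\<lambda>x k. ?f x k - (\<Sum>\<iota>\<in>F'. expansion_term \<Psi> ?b ?Z \<iota> x k)))"
      using spec[OF conjunct2[OF exp[unfolded asymp_sum_def]], of N] by (rule exE)
    \<comment> \<open>The asymptotic expansion permits any finite enlargement of \<open>F\<close>,
      so the index set is made to contain \<open>F_set \<beta>\<close>. The surplus indices are
      returned in the second sum, and lying outside \<open>F_set \<beta>\<close> gives their order
      bound.\<close>
    let ?F' = "F \<union> F_set \<beta>" and ?I = "F - F_set \<beta>"
    have "F_set \<beta> \<subseteq> indices" by (auto simp: F_set_def)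
    then have R: "symbol_class (- real N) (2/3) (1/3) UNIV (\<lambda>s k. ?f (?\<gamma> s) k - (\<Sum>\<iota>\<in>?F'. ?t \<iota> s k))"
      using F finite_F_set[of \<beta>] by (intro symbol_class_curve_symbol[OF \<gamma>]) simp
    have I: "term_order \<iota> \<le> ?\<mu>" if "\<iota> \<in> ?I" for \<iota>
    proof -
      have "\<iota> \<in> indices" using that F by blast
      moreover have "\<not> real \<beta> + 3 * theta \<iota> > 0"
        using that \<open>\<iota> \<in> indices\<close> by (simp add: F_set_def)
      ultimately show ?thesis using theta_eq_term_order[of \<iota>] by simp
    qed
    have \<rho>: "?\<rho> = (\<lambda>s k. (?f (?\<gamma> s) k - (\<Sum>\<iota>\<in>?F'. ?t \<iota> s k)) + (\<Sum>\<iota>\<in>?I. ?t \<iota> s k))"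
    proof (intro ext)
      fix s k
      have "?F' = ?I \<union> F_set \<beta>" by blast
      then have "(\<Sum>\<iota>\<in>?F'. ?t \<iota> s k) = (\<Sum>\<iota>\<in>?I. ?t \<iota> s k) + (\<Sum>\<iota>\<in>F_set \<beta>. ?t \<iota> s k)"
        using F finite_F_set[of \<beta>] by (simp only:) (intro sum.union_disjoint; auto)
      then show "?\<rho> s k = (?f (?\<gamma> s) k - (\<Sum>\<iota>\<in>?F'. ?t \<iota> s k)) + (\<Sum>\<iota>\<in>?I. ?t \<iota> s k)"
        unfolding rho_slow_def sigma_slow_def by simp
    qed
    have I': "finite ?I" "?I \<subseteq> indices" using F by auto
    show ?thesis
      by (rule exI[of _ "\<lambda>s k. ?f (?\<gamma> s) k - (\<Sum>\<iota>\<in>?F'. ?t \<iota> s k)"], rule exI[of _ ?I])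
         (intro conjI ballI R I' I \<rho>)
  qed
  have sym: "symbol_class ?\<mu> (2/3) (1/3) UNIV ?\<rho>"
  proof -
    \<comment> \<open>The choice \<open>N = \<beta>\<close> is enough here, since
      \<open>-\<beta> \<le> -\<beta> / 3\<close>.\<close>
    obtain R I where R: "symbol_class (- real \<beta>) (2/3) (1/3) UNIV R" and I: "finite I" "I \<subseteq> indices"
      "\<And>\<iota>. \<iota> \<in> I \<Longrightarrow> term_order \<iota> \<le> ?\<mu>" and \<rho>: "?\<rho> = (\<lambda>s k. R s k + (\<Sum>\<iota>\<in>I. ?t \<iota> s k))"
      using decomp[of \<beta>] by blast
    show ?thesis
      unfolding \<rho> using I b\<gamma> symbol_class_mono[OF R, of ?\<mu>]
      by (intro symbol_class_add_expansion_terms \<Psi> Z\<gamma>) auto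
  qed
  note du = deriv_unique_on_Icc[OF P]
  obtain D where D: "\<And>s. s \<in> {0..?P} \<Longrightarrow> \<bar>omega (t1 m) (t2 m) s\<bar> \<le> D * \<bar>?Z (?\<gamma> s)\<bar>"
    using omega_le_const_mult_shadow_boundary_function[OF \<gamma> sbf assms(11,12,13)] by blast
  let ?W = "W_weight (t1 m) (t2 m)"
  have "\<exists>C. \<forall>s\<in>{0..?P}. \<forall>k\<ge>k0. norm (mixed_deriv {0..?P} (replicate n 1) 0 ?\<rho> s k)
      \<le> C * k powr ?\<mu> * ?W s k powi (- int n)" if k0: "k0 > 1" for k0 n
  proof -
    \<comment> \<open>Now \<open>N = \<beta> + n\<close>, to leave room for the loss in
      \<open>n\<close> derivatives.\<close>
    obtain R I where R: "symbol_class (- real \<beta> - real n) (2/3) (1/3) UNIV R" and I: "finite I" "I \<subseteq> indices"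
      "\<And>\<iota>. \<iota> \<in> I \<Longrightarrow> term_order \<iota> \<le> ?\<mu>" and \<rho>: "?\<rho> = (\<lambda>s k. R s k + (\<Sum>\<iota>\<in>I. ?t \<iota> s k))"
      using decomp[of "\<beta> + n"] unfolding of_nat_add minus_add_distrib diff_conv_add_uminus
      by blast
    let ?it = "\<lambda>g. iter_dderiv half_plane (replicate n (1, 0)) (case_prod g)"
    obtain C where C: "\<And>s k. s \<in> {0..?P} \<Longrightarrow> k \<ge> k0 \<Longrightarrow>
        norm (?it R (s, k)) * ?W s k ^ n \<le> C * k powr ?\<mu>"
      using remainder_weight_bound[OF R assms(11,12) k0] by blast
    have "\<forall>\<iota>\<in>I. \<exists>E. \<forall>s\<in>{0..?P}. \<forall>k\<ge>k0. norm (?it (?t \<iota>) (s, k)) * ?W s k ^ n \<le> E * k powr ?\<mu>"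
    proof
      fix \<iota> assume "\<iota> \<in> I"
      with I have \<iota>: "\<iota> \<in> indices" "term_order \<iota> \<le> ?\<mu>" by auto
      show "\<exists>E. \<forall>s\<in>{0..?P}. \<forall>k\<ge>k0. norm (?it (?t \<iota>) (s, k)) * ?W s k ^ n \<le> E * k powr ?\<mu>"
        using term_weight_bound[where b = ?b, OF \<Psi> \<iota> b\<gamma>[OF \<iota>(1)] Z\<gamma> D k0] by blast
    qed
    then obtain E where E: "\<And>\<iota> s k. \<iota> \<in> I \<Longrightarrow> s \<in> {0..?P} \<Longrightarrow> k \<ge> k0 \<Longrightarrow>
        norm (?it (?t \<iota>) (s, k)) * ?W s k ^ n \<le> E \<iota> * k powr ?\<mu>"
      by metis
    have smR: "smooth_on half_plane (case_prod R)" by (rule symbol_class_smooth[OF R])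
    have smt: "smooth_on half_plane (case_prod (?t \<iota>))" if "\<iota> \<in> I" for \<iota>
      using that I(2) by (intro symbol_class_smooth[OF expansion_term_bounds(1)] \<Psi> Z\<gamma> b\<gamma>) auto
    have "norm (mixed_deriv {0..?P} (replicate n 1) 0 ?\<rho> s k)
        \<le> (C + (\<Sum>\<iota>\<in>I. E \<iota>)) * k powr ?\<mu> * ?W s k powi (- int n)"
      if s: "s \<in> {0..?P}" and k: "k \<ge> k0" for s k
    proof -
      have kp: "k > 0" using k k0 by simp
      then have x: "(s, k) \<in> half_plane" by simp
      have W: "?W s k > 0" using kp by (rule W_weight_pos)
      \<comment> \<open>Derivatives within the closed interval, one-sided at its endpoints, agree
        with those on the whole line, where the estimates were proved.\<close>
      have "mixed_deriv {0..?P} (replicate n 1) 0 ?\<rho> s k = mixed_deriv UNIV (replicate n 1) 0 ?\<rho> s k"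
        using s kp by (intro mixed_deriv_subset du symbol_class_smooth[OF sym]) auto
      also have "\<dots> = iter_dderiv half_plane (replicate n (1, 0))
          (\<lambda>x. case_prod R x + (\<Sum>\<iota>\<in>I. case_prod (?t \<iota>) x)) (s, k)"
        unfolding mixed_deriv_eq_iter_dderiv \<rho> by (simp add: case_prod_unfold)
      also have "\<dots> = ?it R (s, k) + (\<Sum>\<iota>\<in>I. ?it (?t \<iota>) (s, k))"
        using smR smt I(1) x
        by (simp only: iter_dderiv_add iter_dderiv_sum smooth_on_sum deriv_unique_on_half_plane)
      finally have "norm (mixed_deriv {0..?P} (replicate n 1) 0 ?\<rho> s k)
          \<le> norm (?it R (s, k)) + (\<Sum>\<iota>\<in>I. norm (?it (?t \<iota>) (s, k)))"
        by (simp only:) (intro norm_triangle_mono order_refl norm_sum)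
      then have "norm (mixed_deriv {0..?P} (replicate n 1) 0 ?\<rho> s k) * ?W s k ^ n
          \<le> (norm (?it R (s, k)) + (\<Sum>\<iota>\<in>I. norm (?it (?t \<iota>) (s, k)))) * ?W s k ^ n"
        using W by (intro mult_right_mono) auto
      also have "\<dots> \<le> C * k powr ?\<mu> + (\<Sum>\<iota>\<in>I. E \<iota> * k powr ?\<mu>)"
        unfolding distrib_right sum_distrib_right using C E s k by (intro add_mono sum_mono) auto
      also have "\<dots> = (C + (\<Sum>\<iota>\<in>I. E \<iota>)) * k powr ?\<mu>"
        by (simp add: distrib_right sum_distrib_right)
      \<comment> \<open>The weight is positive, so its \<open>n\<close>-th power can be moved to the
        right-hand side.\<close>
      finally show ?thesis
        using W by (simp add: power_int_minus field_simps)
    qed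
    then show ?thesis by blast
  qed
  moreover have "symbol_class ?\<mu> (2/3) (1/3) {0..?P} ?\<rho>"
    by (rule symbol_class_subset[OF du subset_UNIV sym])
  ultimately show ?thesis by blast
qed

end
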